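(* Let $p\ge1$, let $V,C$ be constant real $p\times p$ matrices, and let $\alpha_0\ne0$, $\alpha_1/\alpha_0<0$, $\alpha_2/\alpha_0>0$. Let $$m_j(t)=\int_0^{+\infty}\lambda_0^je^{j\alpha_0t}\exp\!\Big(\frac{\alpha_1}{\alpha_0}\lambda_0e^{\alpha_0t}-\frac{\alpha_2}{\alpha_0}\lambda_0^{-1}e^{-\alpha_0t}\Big)Ve^{C\ln\lambda_0}\,d\lambda_0,\qquad j\in\mathbb Z,$$ and assume all matrices $\Lambda_{n-1}(t)$, $H_n(t)$, $\tau_n(t)$ (and $b_n(t)$ where needed) built from these moments are invertible. Then for every $n$ and $j$: $$\frac{d}{dt}a_n(t)=0,\qquad \frac{d}{dt}b_n(t)=0,\qquad \frac{d}{dt}\gamma_{n,j}(t)=0,$$ where $P_n(\lambda,t)=\sum_{j=0}^n\gamma_{n,j}(t)\lambda^j$ are the matrix Laurent biorthogonal polynomials. Consequently $a_n,b_n$ satisfy the matrix discrete Painlevé-type equations $$\alpha_0a_n+\alpha_1(-a_{n+1}a_n+a_na_{n-1}+b_na_n-a_nb_{n-1})+\alpha_2(b_n^{-1}a_n-a_nb_{n-1}^{-1})=0,$$ $$\alpha_0b_n+\alpha_1(b_na_n-a_{n+1}b_n)+\alpha_2(b_{n+1}^{-1}a_{n+1}-a_nb_{n-1}^{-1})=0.$$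
   Context: Matrix Laurent biorthogonal polynomials: with $\Lambda_{n-1}=(m_{i-j})_{i,j=0}^{n-1}$ (a block matrix of $p\times p$ blocks) and $\theta_n=(m_n,\dots,m_1)$, $$P_n(\lambda)=\lambda^n\mathbb I_p-\theta_n\Lambda_{n-1}^{-1}(\mathbb I_p,\lambda\mathbb I_p,\dots,\lambda^{n-1}\mathbb I_p)^T.$$ These are the monic matrix polynomials with $\int P_n(\lambda)\,d\mu(\lambda)\,\lambda^{-j}=0$ for $0\le j<n$. Further, $$H_n=m_0-\theta_n\Lambda_{n-1}^{-1}(m_{-n},\dots,m_{-1})^T,\qquad \tau_n=m_{n+1}-\theta_n\Lambda_{n-1}^{-1}(m_1,\dots,m_n)^T,$$ $$a_n=-\tau_n\tau_{n-1}^{-1},\qquad b_n=a_nH_{n-1}H_n^{-1},$$ the coefficients of the recurrence $\lambda(P_n+a_nP_{n-1})=P_{n+1}+b_nP_n$. The convention is $a_0=0$. *)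

theory Defs
  imports "HOL-Analysis.Analysis" "Jordan_Normal_Form.Matrix"
begin

definition minv :: "real mat \<Rightarrow> real mat" where
  "minv A = (if invertible_mat A
     then (SOME B. B \<in> carrier_mat (dim_row A) (dim_row A) \<and> inverts_mat A B \<and> inverts_mat B A)
     else 0\<^sub>m (dim_row A) (dim_row A))"

definition mexp :: "real mat \<Rightarrow> real mat" where
  "mexp A = mat (dim_row A) (dim_row A) (\<lambda>(i,j). \<Sum>k. (A ^\<^sub>m k) $$ (i,j) / fact k)"

definition mom :: "nat \<Rightarrow> real \<Rightarrow> real \<Rightarrow> real \<Rightarrow> real mat \<Rightarrow> real mat \<Rightarrow> real \<Rightarrow> int \<Rightarrow> real mat" where
  "mom p \<alpha>0 \<alpha>1 \<alpha>2 V C t j = mat p p (\<lambda>(r,s).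
     LBINT x:{0<..}. (x powi j * exp (of_int j * \<alpha>0 * t)
        * exp (\<alpha>1 / \<alpha>0 * x * exp (\<alpha>0 * t) - \<alpha>2 / \<alpha>0 * inverse x * exp (- \<alpha>0 * t)))
        * (V * mexp (ln x \<cdot>\<^sub>m C)) $$ (r,s))"

text \<open>Lambda_{n-1} = (m_{i-j})_{i,j=0}^{n-1}, of size (n p) x (n p).\<close>
definition LamB :: "nat \<Rightarrow> (int \<Rightarrow> real mat) \<Rightarrow> nat \<Rightarrow> real mat" where
  "LamB p m n = mat (n*p) (n*p) (\<lambda>(i,j). m (int (i div p) - int (j div p)) $$ (i mod p, j mod p))"

definition thetaB :: "nat \<Rightarrow> (int \<Rightarrow> real mat) \<Rightarrow> nat \<Rightarrow> real mat" where
  "thetaB p m n = mat p (n*p) (\<lambda>(r,c). m (int n - int (c div p)) $$ (r, c mod p))"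

definition colB :: "nat \<Rightarrow> (nat \<Rightarrow> real mat) \<Rightarrow> nat \<Rightarrow> real mat" where
  "colB p f n = mat (n*p) p (\<lambda>(i,s). f (i div p) $$ (i mod p, s))"

text \<open>Coefficients gamma_{n,k} of P_n(lambda) = sum_k gamma_{n,k} lambda^k, where
  P_n(lambda) = lambda^n I - theta_n Lambda_{n-1}^{-1} (I, lambda I, ..., lambda^{n-1} I)^T.\<close>
definition gammaC :: "nat \<Rightarrow> (int \<Rightarrow> real mat) \<Rightarrow> nat \<Rightarrow> nat \<Rightarrow> real mat" where
  "gammaC p m n k = (if k = n then 1\<^sub>m p
     else if k < n then mat p p (\<lambda>(r,s). - (thetaB p m n * minv (LamB p m n)) $$ (r, k*p + s))
     else 0\<^sub>m p p)"

definition HH :: "nat \<Rightarrow> (int \<Rightarrow> real mat) \<Rightarrow> nat \<Rightarrow> real mat" where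
  "HH p m n = m 0 - thetaB p m n * minv (LamB p m n) * colB p (\<lambda>i. m (int i - int n)) n"

definition tauM :: "nat \<Rightarrow> (int \<Rightarrow> real mat) \<Rightarrow> nat \<Rightarrow> real mat" where
  "tauM p m n = m (int n + 1) - thetaB p m n * minv (LamB p m n) * colB p (\<lambda>i. m (int i + 1)) n"

definition aM :: "nat \<Rightarrow> (int \<Rightarrow> real mat) \<Rightarrow> nat \<Rightarrow> real mat" where
  "aM p m n = (if n = 0 then 0\<^sub>m p p else - (tauM p m n * minv (tauM p m (n-1))))"

text \<open>b_n = a_n H_{n-1} H_n^{-1} (n >= 1); b_0 = m_1 m_0^{-1}, forced by the recurrence
  lambda P_0 = P_1 + b_0 P_0.\<close>
definition bM :: "nat \<Rightarrow> (int \<Rightarrow> real mat) \<Rightarrow> nat \<Rightarrow> real mat" where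
  "bM p m n = (if n = 0 then m 1 * minv (m 0)
     else aM p m n * HH p m (n-1) * minv (HH p m n))"

end

(* The substitution x -> x e^(-alpha0 t) gives m_j(t) = m_j(0) K(t) with the invertible matrix
   K(t) = e^(-alpha0 t) e^(-alpha0 t C). Hence gamma_{n,k}, being determined by the orthogonality
   relations, does not depend on t, while H_n and tau_n are only multiplied by K(t) on the right,
   so a_n and b_n are constant.

   For the discrete equations, integrate by parts at t = 0:
     alpha0 j m_j + alpha1 m_{j+1} + alpha2 m_{j-1} = -alpha0 m_j (1 + C).
   Pairing P_n with the powers of lambda yields, besides the three-term recurrence,
     alpha0 (lambda P_n' - n P_n) = alpha1 a_n (lambda P_{n-1} - P_n) - alpha2 b_n^(-1) a_n P_{n-1}.
   At lambda^0 this reads alpha0 n = alpha1 a_n - alpha2 b_n^(-1) a_n b_{n-1}^(-1); multiplying it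
   by b_n on the left, and its successor on the right, the difference is the second equation.
   At lambda^(n-1) it gives the subleading coefficient of P_n, whose increments are a_n - b_n by
   the recurrence; this is the difference of the two equations. *)

theory Submission
  imports Defs "HOL-Probability.Sinc_Integral"
begin

section \<open>The matrix exponential\<close>

lemma index_mult_mat_sum:
  assumes "A \<in> carrier_mat n m" "B \<in> carrier_mat m k" "i < n" "j < k"
  shows "(A * B) $$ (i,j) = (\<Sum>l<m. A $$ (i,l) * B $$ (l,j))"
  using assms by (auto simp: scalar_prod_def atLeast0LessThan)

lemma pow_mat_add:
  fixes C :: "'a::semiring_1 mat"
  assumes "C \<in> carrier_mat p p"
  shows "C ^\<^sub>m (i + k) = C ^\<^sub>m i * C ^\<^sub>m k"
proof (induction k)
  case (Suc k)
  then show ?case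
    using assms by (simp add: assoc_mult_mat[of _ p p _ p _ p])
qed (use assms in auto)

lemma smult_pow_mat:
  fixes C :: "'a::comm_ring_1 mat"
  assumes "C \<in> carrier_mat p p"
  shows "(s \<cdot>\<^sub>m C) ^\<^sub>m k = s ^ k \<cdot>\<^sub>m C ^\<^sub>m k"
proof (induction k)
  case 0
  then show ?case using assms by (intro eq_matI) auto
next
  case (Suc k)
  have "(s ^ k \<cdot>\<^sub>m C ^\<^sub>m k) * (s \<cdot>\<^sub>m C) = s ^ Suc k \<cdot>\<^sub>m (C ^\<^sub>m k * C)"
    using assms by (intro eq_matI) (auto simp: mult_ac)
  with Suc show ?case by simp
qed

text \<open>A crude norm: it only has to dominate every entry, so that the powers of a matrix get
  geometric bounds.\<close>

definition mat_abs_sum :: "real mat \<Rightarrow> real" where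
  "mat_abs_sum C = (\<Sum>i<dim_row C. \<Sum>j<dim_col C. \<bar>C $$ (i,j)\<bar>)"

lemma mat_abs_sum_nonneg: "0 \<le> mat_abs_sum C"
  by (auto simp: mat_abs_sum_def intro!: sum_nonneg)

lemma abs_index_le_mat_abs_sum:
  assumes "C \<in> carrier_mat n m" "i < n" "j < m"
  shows "\<bar>C $$ (i,j)\<bar> \<le> mat_abs_sum C"
proof -
  have "\<bar>C $$ (i,j)\<bar> \<le> (\<Sum>j<dim_col C. \<bar>C $$ (i,j)\<bar>)"
    using assms by (intro member_le_sum) auto
  also have "\<dots> \<le> mat_abs_sum C" unfolding mat_abs_sum_def
    using assms by (intro member_le_sum[of i "{..<dim_row C}" "\<lambda>i. \<Sum>j<dim_col C. \<bar>C $$ (i,j)\<bar>"])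
      (auto intro!: sum_nonneg)
  finally show ?thesis .
qed

text \<open>Each further factor \<open>C\<close> sums \<open>p\<close> products, and each product
  costs at most a factor \<open>mat_abs_sum C\<close>.\<close>

lemma abs_pow_mat_index_le:
  assumes C: "C \<in> carrier_mat p p" and "i < p" "j < p"
  shows "\<bar>(C ^\<^sub>m k) $$ (i,j)\<bar> \<le> (real p * mat_abs_sum C) ^ k"
  using \<open>j < p\<close>
proof (induction k arbitrary: j)
  case 0
  then show ?case using assms by auto
next
  case (Suc k)
  have "\<bar>(C ^\<^sub>m Suc k) $$ (i,j)\<bar> = \<bar>\<Sum>l<p. (C ^\<^sub>m k) $$ (i,l) * C $$ (l,j)\<bar>"
    using assms Suc.prems by (simp add: index_mult_mat_sum[of _ p p _ p] del: index_mult_mat(1))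
  also have "\<dots> \<le> (\<Sum>l<p. \<bar>(C ^\<^sub>m k) $$ (i,l)\<bar> * \<bar>C $$ (l,j)\<bar>)"
    by (rule order_trans[OF sum_abs]) (simp add: abs_mult)
  also have "\<dots> \<le> (\<Sum>l<p. (real p * mat_abs_sum C) ^ k * mat_abs_sum C)"
    using Suc C abs_index_le_mat_abs_sum[OF C]
    by (intro sum_mono mult_mono) (auto simp: mat_abs_sum_nonneg)
  finally show ?case by (simp add: mult_ac)
qed

lemma mexp_carrier [simp]: "C \<in> carrier_mat p p \<Longrightarrow> mexp C \<in> carrier_mat p p"
  by (auto simp: mexp_def)

text \<open>Turns each entry of the exponential into a power series in the real variable
  \<open>s\<close>, to which the theory of real power series applies.\<close>

lemma mexp_smult_index:
  assumes "C \<in> carrier_mat p p" "i < p" "j < p"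
  shows "mexp (s \<cdot>\<^sub>m C) $$ (i,j) = (\<Sum>k. (C ^\<^sub>m k) $$ (i,j) / fact k * s ^ k)"
  using assms pow_carrier_mat[OF assms(1)]
  by (auto simp: mexp_def smult_pow_mat[of _ p] mult_ac intro!: suminf_cong)

lemma mexp_series_bound:
  fixes C :: "real mat"
  assumes "C \<in> carrier_mat p p" "i < p" "j < p"
  shows "norm ((C ^\<^sub>m k) $$ (i,j) / fact k * s ^ k) \<le> (real p * mat_abs_sum C * \<bar>s\<bar>) ^ k /\<^sub>R fact k"
  using mult_right_mono[OF abs_pow_mat_index_le[OF assms, of k], of "\<bar>s\<bar> ^ k / fact k"]
  by (simp add: abs_mult power_abs field_simps)

lemma mexp_series_summable:
  fixes C :: "real mat"
  assumes "C \<in> carrier_mat p p" "i < p" "j < p"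
  shows "summable (\<lambda>k. norm ((C ^\<^sub>m k) $$ (i,j) / fact k * s ^ k))"
  by (rule summable_comparison_test'[OF summable_exp_generic[of "real p * mat_abs_sum C * \<bar>s\<bar>"]])
    (use mexp_series_bound[OF assms] in simp)

text \<open>With \<open>s = ln x\<close> this bound is a power of \<open>x\<close> or of
  \<open>1/x\<close>, which the weight absorbs at both ends of the half-line.\<close>

lemma abs_mexp_smult_index_le:
  assumes "C \<in> carrier_mat p p" "i < p" "j < p"
  shows "\<bar>mexp (s \<cdot>\<^sub>m C) $$ (i,j)\<bar> \<le> exp (real p * mat_abs_sum C * \<bar>s\<bar>)"
proof -
  have "\<bar>mexp (s \<cdot>\<^sub>m C) $$ (i,j)\<bar> \<le> (\<Sum>k. norm ((C ^\<^sub>m k) $$ (i,j) / fact k * s ^ k))"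
    unfolding mexp_smult_index[OF assms]
    using summable_norm[OF mexp_series_summable[OF assms]] by simp
  also have "\<dots> \<le> (\<Sum>k. (real p * mat_abs_sum C * \<bar>s\<bar>) ^ k /\<^sub>R fact k)"
    by (intro suminf_le mexp_series_bound[OF assms] mexp_series_summable[OF assms] summable_exp_generic)
  finally show ?thesis by (simp add: exp_def)
qed

text \<open>Termwise differentiation. The factor \<open>C\<close> is kept on the right, because
  there it can be pulled out of the moment integrals.\<close>

lemma mexp_smult_index_DERIV:
  assumes C: "C \<in> carrier_mat p p" and ij: "i < p" "j < p"
  shows "((\<lambda>s. mexp (s \<cdot>\<^sub>m C) $$ (i,j)) has_real_derivative (mexp (s \<cdot>\<^sub>m C) * C) $$ (i,j)) (at s)"
proof -
  define c where "c = (\<lambda>i j k. (C ^\<^sub>m k) $$ (i,j) / fact k)"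
  have sm: "summable (\<lambda>k. c i l k * y ^ k)" if "l < p" for l y
    using summable_norm_cancel[OF mexp_series_summable[OF C \<open>i < p\<close> that, of y]] by (simp add: c_def)
  \<comment> \<open>The last factor of \<open>C ^\<^sub>m Suc k\<close> is split off on the right,
    and \<open>Suc k\<close> cancels against the factorial.\<close>
  have dc: "diffs (c i j) k = (\<Sum>l<p. c i l k * C $$ (l,j))" for k
    using C ij by (simp add: diffs_def c_def index_mult_mat_sum[of _ p p _ p]
        sum_divide_distrib sum_distrib_left field_simps del: of_nat_Suc index_mult_mat(1))
  have "((\<lambda>s. \<Sum>k. c i j k * s ^ k) has_real_derivative (\<Sum>k. diffs (c i j) k * s ^ k)) (at s)"
    by (rule termdiffs_strong_converges_everywhere) (use sm ij in auto)
  moreover have "(\<Sum>k. diffs (c i j) k * s ^ k) = (\<Sum>k. \<Sum>l<p. c i l k * s ^ k * C $$ (l,j))"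
    by (intro suminf_cong) (simp add: dc sum_distrib_left mult_ac)
  moreover have "\<dots> = (\<Sum>l<p. \<Sum>k. c i l k * s ^ k * C $$ (l,j))"
    by (rule suminf_sum) (use sm in \<open>auto intro: summable_mult2\<close>)
  moreover have "\<dots> = (\<Sum>l<p. (\<Sum>k. c i l k * s ^ k) * C $$ (l,j))"
    by (intro sum.cong refl suminf_mult2[symmetric]) (use sm in auto)
  moreover have "\<dots> = (mexp (s \<cdot>\<^sub>m C) * C) $$ (i,j)"
    using C ij by (simp add: index_mult_mat_sum[of _ p p _ p] mexp_smult_index[of _ p] c_def del: index_mult_mat(1))
  ultimately show ?thesis
    using C ij by (simp add: mexp_smult_index c_def)
qed

text \<open>Cauchy product of the entry series: only powers of the single matrix \<open>C\<close>
  occur, so the coefficients collapse by the binomial theorem.\<close>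

lemma mexp_add_smult:
  assumes C: "C \<in> carrier_mat p p"
  shows "mexp ((s + u) \<cdot>\<^sub>m C) = mexp (s \<cdot>\<^sub>m C) * mexp (u \<cdot>\<^sub>m C)"
proof (rule eq_matI)
  define c where "c = (\<lambda>s i j k. (C ^\<^sub>m k) $$ (i,j) / fact k * s ^ k)"
  fix i j assume "i < dim_row (mexp (s \<cdot>\<^sub>m C) * mexp (u \<cdot>\<^sub>m C))" "j < dim_col (mexp (s \<cdot>\<^sub>m C) * mexp (u \<cdot>\<^sub>m C))"
  then have ij: "i < p" "j < p" using C by (auto simp: mexp_def)
  have coeff: "(\<Sum>l<p. \<Sum>r\<le>k. c s i l r * c u l j (k - r)) = c (s + u) i j k" for k
  proof -
    have "(\<Sum>l<p. \<Sum>r\<le>k. c s i l r * c u l j (k - r))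
        = (\<Sum>r\<le>k. (s ^ r * u ^ (k - r) / (fact r * fact (k - r))) * (\<Sum>l<p. (C ^\<^sub>m r) $$ (i,l) * (C ^\<^sub>m (k - r)) $$ (l,j)))"
      by (subst sum.swap) (simp add: c_def sum_distrib_left mult_ac)
    also have "\<dots> = (\<Sum>r\<le>k. (s ^ r * u ^ (k - r) / (fact r * fact (k - r))) * (C ^\<^sub>m k) $$ (i,j))"
    proof (intro sum.cong refl, goal_cases)
      case (1 r)
      then have "C ^\<^sub>m k = C ^\<^sub>m r * C ^\<^sub>m (k - r)"
        using pow_mat_add[OF C, of r "k - r"] by simp
      then show ?case
        using ij C by (simp add: index_mult_mat_sum[of _ p p _ p] del: index_mult_mat(1))
    qed
    also have "\<dots> = c (s + u) i j k"
      by (simp add: c_def binomial_ring binomial_fact sum_distrib_left sum_distrib_right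
          sum_divide_distrib field_simps)
    finally show ?thesis .
  qed
  have "(\<lambda>k. \<Sum>l<p. \<Sum>r\<le>k. c s i l r * c u l j (k - r)) sums (\<Sum>l<p. (\<Sum>k. c s i l k) * (\<Sum>k. c u l j k))"
    by (intro sums_sum Cauchy_product_sums) (use mexp_series_summable[OF C] ij in \<open>auto simp: c_def\<close>)
  then have "(\<Sum>k. c (s + u) i j k) = (\<Sum>l<p. (\<Sum>k. c s i l k) * (\<Sum>k. c u l j k))"
    unfolding coeff by (rule sums_unique[symmetric])
  then show "mexp ((s + u) \<cdot>\<^sub>m C) $$ (i,j) = (mexp (s \<cdot>\<^sub>m C) * mexp (u \<cdot>\<^sub>m C)) $$ (i,j)"
    using C ij by (simp add: index_mult_mat_sum[of _ p p _ p] mexp_smult_index[of _ p] c_def del: index_mult_mat(1))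
qed (use C in \<open>auto simp: mexp_def\<close>)

lemma mexp_0_smult:
  assumes C: "C \<in> carrier_mat p p"
  shows "mexp (0 \<cdot>\<^sub>m C) = 1\<^sub>m p"
proof (rule eq_matI)
  fix i j assume ij: "i < dim_row (1\<^sub>m p :: real mat)" "j < dim_col (1\<^sub>m p :: real mat)"
  then have "mexp (0 \<cdot>\<^sub>m C) $$ (i,j) = (\<Sum>k. (C ^\<^sub>m k) $$ (i,j) / fact k * 0 ^ k)"
    using C by (simp add: mexp_smult_index)
  also have "\<dots> = 1\<^sub>m p $$ (i,j)"
    using C ij by (subst powser_zero) auto
  finally show "mexp (0 \<cdot>\<^sub>m C) $$ (i,j) = 1\<^sub>m p $$ (i,j)" .
qed (use C in \<open>auto simp: mexp_def\<close>)

section \<open>Integrals against the weight\<close>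

text \<open>A single term of the exponential series is at most the whole sum.\<close>

lemma power_le_fact_exp:
  fixes y :: real
  assumes "0 \<le> y"
  shows "y ^ n \<le> fact n * exp y"
proof -
  have "(\<Sum>k\<in>{n}. y ^ k /\<^sub>R fact k) \<le> (\<Sum>k. y ^ k /\<^sub>R fact k)"
    by (rule sum_le_suminf) (use assms summable_exp_generic[of y] in auto)
  then show ?thesis by (simp add: exp_def field_simps)
qed

text \<open>The factor \<open>exp (d * |ln x|)\<close> is a power of \<open>x\<close> or of
  \<open>1/x\<close>. Near 0 the term with \<open>b\<close> beats all powers, near infinity half of
  the rate \<open>a\<close> does; the other half remains as an integrable majorant.\<close>

lemma weight_bound:
  fixes a b d :: real
  assumes "0 < a" "0 < b"
  obtains K where "\<And>x. 0 < x \<Longrightarrow>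
    x powi j * exp (- (a * x) - b * inverse x) * exp (d * \<bar>ln x\<bar>) \<le> K * exp (- (x * (a / 2)))"
proof
  \<comment> \<open>\<open>N\<close> bounds the total exponent, so
    \<open>x ^ N + inverse x ^ N\<close> covers both sides of \<open>x = 1\<close>.\<close>
  define N where "N = nat \<lceil>\<bar>of_int j\<bar> + \<bar>d\<bar>\<rceil>"
  define K where "K = fact N * (2 / a) ^ N + fact N * (1 / b) ^ N"
  fix x :: real assume "0 < x"
  have N: "\<bar>of_int j\<bar> + \<bar>d\<bar> \<le> real N" unfolding N_def by linarith
  have "x powi j * exp (d * \<bar>ln x\<bar>) = exp (of_int j * ln x + d * \<bar>ln x\<bar>)"
    using \<open>0 < x\<close> by (simp add: powr_real_of_int' [symmetric] powr_def exp_add)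
  also have "\<dots> \<le> exp (real N * \<bar>ln x\<bar>)"
  proof -
    have "of_int j * ln x + d * \<bar>ln x\<bar> \<le> \<bar>of_int j * ln x\<bar> + \<bar>d\<bar> * \<bar>ln x\<bar>"
      by (intro add_mono abs_ge_self mult_right_mono) auto
    also have "\<dots> = (\<bar>of_int j\<bar> + \<bar>d\<bar>) * \<bar>ln x\<bar>" by (simp add: abs_mult algebra_simps)
    also have "\<dots> \<le> real N * \<bar>ln x\<bar>" using N by (intro mult_right_mono) auto
    finally show ?thesis by simp
  qed
  also have "\<dots> \<le> x ^ N + inverse x ^ N"
    using \<open>0 < x\<close> by (cases "ln x \<ge> 0") (auto simp: exp_of_nat_mult exp_minus power_inverse)
  finally have 1: "x powi j * exp (d * \<bar>ln x\<bar>) \<le> x ^ N + inverse x ^ N" .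
  \<comment> \<open>Half of the rate \<open>a\<close> pays for \<open>x ^ N\<close>; in the next
    estimate all of \<open>b\<close> pays for \<open>inverse x ^ N\<close>.\<close>
  have 2: "x ^ N \<le> fact N * (2 / a) ^ N * exp (a / 2 * x)"
    using power_le_fact_exp[of "a / 2 * x" N] \<open>0 < x\<close> \<open>0 < a\<close>
    by (simp add: field_simps power_mult_distrib)
  have 3: "inverse x ^ N \<le> fact N * (1 / b) ^ N * exp (b * inverse x)"
    using power_le_fact_exp[of "b * inverse x" N] \<open>0 < x\<close> \<open>0 < b\<close>
    by (simp add: field_simps power_mult_distrib)
  have "x powi j * exp (- (a * x) - b * inverse x) * exp (d * \<bar>ln x\<bar>)
      \<le> (x ^ N + inverse x ^ N) * exp (- (a * x) - b * inverse x)"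
    using mult_right_mono[OF 1, of "exp (- (a * x) - b * inverse x)"] by (simp add: mult_ac)
  also have "\<dots> \<le> (fact N * (2 / a) ^ N * exp (a / 2 * x) + fact N * (1 / b) ^ N * exp (b * inverse x))
      * exp (- (a * x) - b * inverse x)"
    using 2 3 by (intro mult_right_mono add_mono) auto
  also have "\<dots> = fact N * (2 / a) ^ N * exp (- (x * (a / 2)) - b * inverse x) + fact N * (1 / b) ^ N * exp (- (a * x))"
    by (simp add: distrib_right mult.assoc flip: exp_add)
  also have "\<dots> \<le> fact N * (2 / a) ^ N * exp (- (x * (a / 2))) + fact N * (1 / b) ^ N * exp (- (x * (a / 2)))"
    using assms \<open>0 < x\<close> by (intro add_mono mult_left_mono) auto
  finally show "x powi j * exp (- (a * x) - b * inverse x) * exp (d * \<bar>ln x\<bar>) \<le> K * exp (- (x * (a / 2)))"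
    by (simp add: K_def distrib_right)
qed

text \<open>Growth is measured in \<open>s = ln x\<close>, the variable in which the matrix part of
  the weight is an exponential; in terms of \<open>x\<close> it is at most polynomial growth in
  \<open>x\<close> and \<open>1/x\<close>.\<close>

definition exp_growth :: "(real \<Rightarrow> real) \<Rightarrow> bool" where
  "exp_growth g \<longleftrightarrow> (\<exists>K d. \<forall>s. \<bar>g s\<bar> \<le> K * exp (d * \<bar>s\<bar>))"

lemma exp_growth_weight_bound:
  assumes "exp_growth g" "0 < a" "0 < b"
  obtains K where "\<And>x. 0 < x \<Longrightarrow>
    \<bar>x powi j * exp (- (a * x) - b * inverse x) * g (ln x)\<bar> \<le> K * exp (- (x * (a / 2)))"
proof -
  obtain K d where g: "\<And>s. \<bar>g s\<bar> \<le> K * exp (d * \<bar>s\<bar>)"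
    using assms(1) by (auto simp: exp_growth_def)
  have "0 \<le> K" using g[of 0] by simp
  obtain K' where K': "\<And>x. 0 < x \<Longrightarrow>
    x powi j * exp (- (a * x) - b * inverse x) * exp (d * \<bar>ln x\<bar>) \<le> K' * exp (- (x * (a / 2)))"
    using weight_bound[OF assms(2,3)] by blast
  show thesis
  proof (rule that[of "K * K'"])
    fix x :: real assume "0 < x"
    then have "\<bar>x powi j * exp (- (a * x) - b * inverse x) * g (ln x)\<bar>
        = x powi j * exp (- (a * x) - b * inverse x) * \<bar>g (ln x)\<bar>"
      by (simp add: abs_mult)
    also have "\<dots> \<le> x powi j * exp (- (a * x) - b * inverse x) * (K * exp (d * \<bar>ln x\<bar>))"
      using g \<open>0 < x\<close> by (intro mult_left_mono) auto
    also have "\<dots> = K * (x powi j * exp (- (a * x) - b * inverse x) * exp (d * \<bar>ln x\<bar>))"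
      by (simp add: mult_ac)
    also have "\<dots> \<le> K * (K' * exp (- (x * (a / 2))))"
      using K'[OF \<open>0 < x\<close>] \<open>0 \<le> K\<close> by (intro mult_left_mono) auto
    finally show "\<bar>x powi j * exp (- (a * x) - b * inverse x) * g (ln x)\<bar> \<le> K * K' * exp (- (x * (a / 2)))"
      by (simp add: mult_ac)
  qed
qed

lemma integrable_weight:
  assumes "exp_growth g" "continuous_on UNIV g" "0 < a" "0 < b"
  shows "set_integrable lborel {0<..} (\<lambda>x::real. x powi j * exp (- (a * x) - b * inverse x) * g (ln x))"
proof -
  obtain K where K: "\<And>x. 0 < x \<Longrightarrow>
    \<bar>x powi j * exp (- (a * x) - b * inverse x) * g (ln x)\<bar> \<le> K * exp (- (x * (a / 2)))"
    using exp_growth_weight_bound[OF assms(1,3,4)] by blast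
  have cont: "continuous_on {0<..} (\<lambda>x::real. x powi j * exp (- (a * x) - b * inverse x) * g (ln x))"
    by (intro continuous_intros continuous_on_compose2[OF assms(2)]) auto
  show ?thesis
  proof (rule set_integrable_bound)
    show "set_integrable lborel {0<..} (\<lambda>x. K * exp (- (x * (a / 2))))"
      using integrable_I0i_exp_mscale[of "a / 2"] assms by (intro set_integrable_mult_right) auto
    show "set_borel_measurable lborel {0<..} (\<lambda>x::real. x powi j * exp (- (a * x) - b * inverse x) * g (ln x))"
      using borel_measurable_continuous_on_indicator[OF _ cont] by (simp add: set_borel_measurable_def)
  qed (use K in \<open>auto intro!: AE_I2 order_trans[OF K]\<close>)
qed

text \<open>The left side is the integral of the derivative of
  \<open>x powi (j + 1) * exp (- (a * x) - b * inverse x) * g (ln x)\<close>, whose limits at 0 and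
  at infinity vanish. The chain rule for \<open>g (ln x)\<close> loses one power of
  \<open>x\<close>, hence the term \<open>I j g'\<close>.\<close>

lemma weight_by_parts:
  assumes g: "\<And>s. (g has_real_derivative g' s) (at s)"
    and "continuous_on UNIV g'" "exp_growth g" "exp_growth g'" "0 < a" "0 < b"
  defines "I \<equiv> \<lambda>j g. LBINT x:{0<..}. x powi j * exp (- (a * x) - b * inverse x) * g (ln x)"
  shows "(of_int j + 1) * I j g - a * I (j + 1) g + b * I (j - 1) g + I j g' = 0"
proof -
  let ?w = "\<lambda>j g x. x powi j * exp (- (a * x) - b * inverse x) * (g (ln x) :: real)"
  define f where "f = (\<lambda>x. (of_int j + 1) * ?w j g x - a * ?w (j + 1) g x + b * ?w (j - 1) g x + ?w j g' x)"
  have cg: "continuous_on UNIV g"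
    using g by (meson DERIV_continuous_on has_field_derivative_at_within)
  note int = integrable_weight[OF \<open>exp_growth g\<close> cg \<open>0 < a\<close> \<open>0 < b\<close>]
    integrable_weight[OF \<open>exp_growth g'\<close> assms(2) \<open>0 < a\<close> \<open>0 < b\<close>]
  have fint: "set_integrable lborel {0<..} f"
    unfolding f_def by (intro set_integral_add set_integral_diff set_integrable_mult_right int)
  have "(LBINT x:{0<..}. f x) = (of_int j + 1) * I j g - a * I (j + 1) g + b * I (j - 1) g + I j g'"
    unfolding f_def I_def
    by (simp add: set_integral_add set_integral_diff set_integrable_mult_right int)
  moreover have "(LBINT x=0..\<infinity>. f x) = 0 - 0"
  proof (rule interval_integral_FTC_integrable[where F = "?w (j + 1) g"])
    obtain K where K: "\<And>x. 0 < x \<Longrightarrow> \<bar>?w j g x\<bar> \<le> K * exp (- (x * (a / 2)))"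
      using exp_growth_weight_bound[OF \<open>exp_growth g\<close> \<open>0 < a\<close> \<open>0 < b\<close>] by blast
    \<comment> \<open>The majorant of the weight does not vanish at 0. Splitting one factor
      \<open>x\<close> off the antiderivative gives a bound that tends to 0 at both ends.\<close>
    have bound: "norm (?w (j + 1) g x) \<le> x * (K * exp (- (x * (a / 2))))" if "0 < x" for x
    proof -
      have "?w (j + 1) g x = x * ?w j g x" using that by (simp add: power_int_add mult_ac)
      then have "norm (?w (j + 1) g x) = x * \<bar>?w j g x\<bar>"
        using that by (simp only: real_norm_def abs_mult[of x] abs_of_pos)
      also have "\<dots> \<le> x * (K * exp (- (x * (a / 2))))"
        using K[OF that] that by (intro mult_left_mono) auto
      finally show ?thesis .
    qed
    show "((?w (j + 1) g \<circ> real_of_ereal) \<longlongrightarrow> 0) (at_right 0)"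
      unfolding zero_ereal_def ereal_tendsto_simps1
    proof (rule Lim_null_comparison)
      show "\<forall>\<^sub>F x in at_right 0. norm (?w (j + 1) g x) \<le> x * (K * exp (- (x * (a / 2))))"
        using bound by (auto simp: eventually_at_right_field intro: gt_ex)
      show "((\<lambda>x. x * (K * exp (- (x * (a / 2))))) \<longlongrightarrow> 0) (at_right 0)"
        by (auto intro!: tendsto_eq_intros)
    qed
    show "((?w (j + 1) g \<circ> real_of_ereal) \<longlongrightarrow> 0) (at_left \<infinity>)"
      unfolding ereal_tendsto_simps1
    proof (rule Lim_null_comparison)
      show "\<forall>\<^sub>F x in at_top. norm (?w (j + 1) g x) \<le> x * (K * exp (- (x * (a / 2))))"
        using eventually_gt_at_top[of 0] by eventually_elim (use bound in auto)
      show "((\<lambda>x. x * (K * exp (- (x * (a / 2))))) \<longlongrightarrow> 0) at_top"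
        using \<open>0 < a\<close> by real_asymp
    qed
    fix x assume "0 < ereal x" "ereal x < \<infinity>"
    then have x: "0 < x" by simp
    have "((\<lambda>x. ?w (j + 1) g x) has_real_derivative f x) (at x)"
      unfolding f_def using x
      apply (auto intro!: derivative_eq_intros DERIV_chain'[where g = g] g)
      by (simp add: power_int_add power_int_diff field_simps power2_eq_square)
    then show "(?w (j + 1) g has_vector_derivative f x) (at x)"
      by (simp add: has_real_derivative_iff_has_vector_derivative)
    have "continuous_on {0<..} f"
      unfolding f_def
      by (intro continuous_intros continuous_on_compose2[OF cg] continuous_on_compose2[OF assms(2)]) auto
    then show "isCont f x"
      using x by (simp add: continuous_on_eq_continuous_at)
  next
    show "set_integrable lborel (einterval 0 \<infinity>) f"
      using fint by (simp add: einterval_def greaterThan_def)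
  qed auto
  ultimately show ?thesis by (simp add: interval_lebesgue_integral_0_infty)
qed

lemma weight_integral_scale:
  assumes "0 < c"
  shows "(LBINT x:{0<..}. h x) = c * (LBINT x:{0<..}. (h (c * x) :: real))"
  using assms lborel_integral_real_affine[of c "\<lambda>x. indicator {0<..} x *\<^sub>R h x" 0]
  by (simp add: set_lebesgue_integral_def indicator_def zero_less_mult_iff)

section \<open>Linear combinations of functions of exponential growth\<close>

lemma exp_growth_add:
  assumes "exp_growth g" "exp_growth h"
  shows "exp_growth (\<lambda>s. g s + h s)"
proof -
  obtain K d where g: "\<And>s. \<bar>g s\<bar> \<le> K * exp (d * \<bar>s\<bar>)"
    using assms(1) by (auto simp: exp_growth_def)
  obtain L e where h: "\<And>s. \<bar>h s\<bar> \<le> L * exp (e * \<bar>s\<bar>)"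
    using assms(2) by (auto simp: exp_growth_def)
  have "0 \<le> K" "0 \<le> L" using g[of 0] h[of 0] by auto
  have "\<bar>g s + h s\<bar> \<le> (K + L) * exp (max d e * \<bar>s\<bar>)" for s
  proof -
    have "\<bar>g s + h s\<bar> \<le> K * exp (d * \<bar>s\<bar>) + L * exp (e * \<bar>s\<bar>)"
      using g[of s] h[of s] by linarith
    also have "\<dots> \<le> K * exp (max d e * \<bar>s\<bar>) + L * exp (max d e * \<bar>s\<bar>)"
      using \<open>0 \<le> K\<close> \<open>0 \<le> L\<close>
      by (intro add_mono mult_left_mono) (auto intro: mult_right_mono)
    finally show ?thesis by (simp add: distrib_right)
  qed
  then show ?thesis unfolding exp_growth_def by blast
qed

lemma exp_growth_mult_right:
  assumes "exp_growth g"
  shows "exp_growth (\<lambda>s. g s * c)"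
proof -
  obtain K d where "\<And>s. \<bar>g s\<bar> \<le> K * exp (d * \<bar>s\<bar>)"
    using assms by (auto simp: exp_growth_def)
  then have "\<bar>g s * c\<bar> \<le> (K * \<bar>c\<bar>) * exp (d * \<bar>s\<bar>)" for s
    using mult_right_mono[of "\<bar>g s\<bar>" "K * exp (d * \<bar>s\<bar>)" "\<bar>c\<bar>"] by (simp add: abs_mult mult_ac)
  then show ?thesis unfolding exp_growth_def by blast
qed

lemma exp_growth_sum:
  "finite A \<Longrightarrow> (\<And>i. i \<in> A \<Longrightarrow> exp_growth (g i)) \<Longrightarrow> exp_growth (\<lambda>s. \<Sum>i\<in>A. g i s)"
proof (induction A rule: finite_induct)
  case empty
  then show ?case by (auto simp: exp_growth_def intro!: exI[of _ 0])
qed (auto intro: exp_growth_add)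

section \<open>The moments\<close>

lemma mom_carrier: "mom p \<alpha>0 \<alpha>1 \<alpha>2 V C t j \<in> carrier_mat p p"
  by (simp add: mom_def)

context
  fixes p :: nat and V C :: "real mat"
  assumes V: "V \<in> carrier_mat p p" and C: "C \<in> carrier_mat p p"
begin

abbreviation VexpC :: "real \<Rightarrow> real mat" where
  "VexpC s \<equiv> V * mexp (s \<cdot>\<^sub>m C)"

lemma VexpC_carrier: "VexpC s \<in> carrier_mat p p"
  using V C by (auto intro!: mult_carrier_mat mexp_carrier)

lemma VexpC_index:
  assumes "r < p" "c < p"
  shows "VexpC s $$ (r,c) = (\<Sum>l<p. mexp (s \<cdot>\<^sub>m C) $$ (l,c) * V $$ (r,l))"
  using V C assms by (simp add: index_mult_mat_sum[of _ p p _ p] mult_ac del: index_mult_mat(1))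

lemma VexpC_exp_growth:
  assumes "r < p" "c < p"
  shows "exp_growth (\<lambda>s. VexpC s $$ (r,c))"
proof -
  have "exp_growth (\<lambda>s. mexp (s \<cdot>\<^sub>m C) $$ (l,c))" if "l < p" for l
    unfolding exp_growth_def using abs_mexp_smult_index_le[OF C that \<open>c < p\<close>]
    by (intro exI[of _ 1] exI[of _ "real p * mat_abs_sum C"]) simp
  then show ?thesis
    unfolding VexpC_index[OF assms] by (intro exp_growth_sum exp_growth_mult_right) auto
qed

text \<open>This makes the term with \<open>g'\<close> in the integration by parts again a moment,
  multiplied by \<open>C\<close> on the right.\<close>

lemma VexpC_DERIV:
  assumes "r < p" "c < p"
  shows "((\<lambda>s. VexpC s $$ (r,c)) has_real_derivative (VexpC s * C) $$ (r,c)) (at s)"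
proof -
  have "((\<lambda>s. VexpC s $$ (r,c)) has_real_derivative (\<Sum>l<p. (mexp (s \<cdot>\<^sub>m C) * C) $$ (l,c) * V $$ (r,l))) (at s)"
    unfolding VexpC_index[OF assms]
    by (intro DERIV_sum DERIV_cmult_right mexp_smult_index_DERIV[OF C]) (use assms in auto)
  also have "(\<Sum>l<p. (mexp (s \<cdot>\<^sub>m C) * C) $$ (l,c) * V $$ (r,l)) = (V * (mexp (s \<cdot>\<^sub>m C) * C)) $$ (r,c)"
    using assms by (subst index_mult_mat_sum[OF V mult_carrier_mat[OF mexp_carrier C]])
      (auto simp: C mult_ac simp del: index_mult_mat(1))
  also have "V * (mexp (s \<cdot>\<^sub>m C) * C) = VexpC s * C"
    using V C by (intro assoc_mult_mat[symmetric]) auto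
  finally show ?thesis .
qed

lemma VexpC_mult_index:
  assumes "r < p" "c < p" "B \<in> carrier_mat p p"
  shows "(VexpC s * B) $$ (r,c) = (\<Sum>l<p. VexpC s $$ (r,l) * B $$ (l,c))"
  by (rule index_mult_mat_sum[OF VexpC_carrier]) (use assms in auto)

lemma VexpC_continuous:
  assumes "r < p" "c < p"
  shows "continuous_on UNIV (\<lambda>s. VexpC s $$ (r,c))"
  using VexpC_DERIV[OF assms] by (meson DERIV_continuous_on has_field_derivative_at_within)

text \<open>Rescaling \<open>x\<close> shifts \<open>ln x\<close>, and so acts on the matrix part of
  the weight by a constant right factor.\<close>

lemma VexpC_add: "VexpC (s + u) = VexpC s * mexp (u \<cdot>\<^sub>m C)"
  unfolding mexp_add_smult[OF C] using V C by (intro assoc_mult_mat[of _ p p _ p _ p, symmetric]) auto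

context
  fixes \<alpha>0 \<alpha>1 \<alpha>2 :: real
  assumes \<alpha>: "\<alpha>0 \<noteq> 0" "\<alpha>1 / \<alpha>0 < 0" "\<alpha>2 / \<alpha>0 > 0"
begin

text \<open>The weight at \<open>t = 0\<close>, written with a double negation so that it matches
  the general weight with the positive rates \<open>a = - (\<alpha>1 / \<alpha>0)\<close> and
  \<open>b = \<alpha>2 / \<alpha>0\<close>.\<close>

abbreviation weight_int :: "int \<Rightarrow> (real \<Rightarrow> real) \<Rightarrow> real" where
  "weight_int j g \<equiv> LBINT x:{0<..}. x powi j * exp (- (- (\<alpha>1 / \<alpha>0) * x) - \<alpha>2 / \<alpha>0 * inverse x) * g (ln x)"

text \<open>A constant right factor leaves the integral by linearity; integrability of each entry
  justifies exchanging sum and integral.\<close>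

lemma weight_int_sum:
  assumes "r < p" "c < p" "B \<in> carrier_mat p p"
  shows "weight_int j (\<lambda>s. (VexpC s * B) $$ (r,c)) = (\<Sum>l<p. weight_int j (\<lambda>s. VexpC s $$ (r,l)) * B $$ (l,c))"
proof -
  have "set_integrable lborel {0<..} (\<lambda>x::real. x powi j * exp (- (- (\<alpha>1 / \<alpha>0) * x) - \<alpha>2 / \<alpha>0 * inverse x)
      * VexpC (ln x) $$ (r,l))" if "l < p" for l
    using \<alpha> by (intro integrable_weight VexpC_exp_growth VexpC_continuous assms that) auto
  then show ?thesis
    unfolding set_lebesgue_integral_def set_integrable_def VexpC_mult_index[OF assms]
    by (simp add: sum_distrib_left flip: mult.assoc)
qed

section \<open>Time dependence of the moments and their recurrence at time 0\<close>

lemma mom_0_index: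
  assumes "r < p" "c < p"
  shows "mom p \<alpha>0 \<alpha>1 \<alpha>2 V C 0 j $$ (r,c) = weight_int j (\<lambda>s. VexpC s $$ (r,c))"
  using assms by (simp add: mom_def)

text \<open>Under the substitution of \<open>exp (- \<alpha>0 * t) * x\<close> for \<open>x\<close>
  all explicit time factors cancel. What is left is the Jacobian and the shift of
  \<open>ln x\<close>, both independent of \<open>j\<close>.\<close>

lemma mom_scaling:
  "mom p \<alpha>0 \<alpha>1 \<alpha>2 V C t j
    = mom p \<alpha>0 \<alpha>1 \<alpha>2 V C 0 j * (exp (- \<alpha>0 * t) \<cdot>\<^sub>m mexp ((- \<alpha>0 * t) \<cdot>\<^sub>m C))"
proof (rule eq_matI)
  let ?B = "mexp ((- \<alpha>0 * t) \<cdot>\<^sub>m C)" and ?c = "exp (- \<alpha>0 * t)"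
  have B: "?B \<in> carrier_mat p p" using C by auto
  fix r c assume "r < dim_row (mom p \<alpha>0 \<alpha>1 \<alpha>2 V C 0 j * (?c \<cdot>\<^sub>m ?B))" "c < dim_col (mom p \<alpha>0 \<alpha>1 \<alpha>2 V C 0 j * (?c \<cdot>\<^sub>m ?B))"
  then have rc: "r < p" "c < p" using B by (auto simp: mom_def)
  have "mom p \<alpha>0 \<alpha>1 \<alpha>2 V C t j $$ (r,c) = (LBINT x:{0<..}. x powi j * exp (of_int j * \<alpha>0 * t)
        * exp (\<alpha>1 / \<alpha>0 * x * exp (\<alpha>0 * t) - \<alpha>2 / \<alpha>0 * inverse x * exp (- \<alpha>0 * t)) * VexpC (ln x) $$ (r,c))"
    using rc by (simp add: mom_def)
  also have "\<dots> = ?c * (LBINT x:{0<..}. (?c * x) powi j * exp (of_int j * \<alpha>0 * t)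
        * exp (\<alpha>1 / \<alpha>0 * (?c * x) * exp (\<alpha>0 * t) - \<alpha>2 / \<alpha>0 * inverse (?c * x) * exp (- \<alpha>0 * t)) * VexpC (ln (?c * x)) $$ (r,c))"
    by (rule weight_integral_scale) simp
  also have "\<dots> = ?c * weight_int j (\<lambda>s. (VexpC s * ?B) $$ (r,c))"
  proof (intro arg_cong[where f = "\<lambda>x. ?c * x"] set_lebesgue_integral_cong ballI allI impI)
    fix x :: real assume "x \<in> {0<..}"
    then have x: "0 < x" by simp
    have "?c powi j = exp (- (of_int j * \<alpha>0 * t))"
      by (simp add: powr_real_of_int' [symmetric] powr_def)
    then have 1: "(?c * x) powi j * exp (of_int j * \<alpha>0 * t) = x powi j"
      by (simp add: power_int_mult_distrib flip: exp_add)
    have "?c * exp (\<alpha>0 * t) = 1" by (simp flip: exp_add)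
    then have 2: "\<alpha>1 / \<alpha>0 * (?c * x) * exp (\<alpha>0 * t) = - (- (\<alpha>1 / \<alpha>0) * x)"
      by (simp add: mult_ac)
    have 3: "inverse (?c * x) * ?c = inverse x" by (simp add: field_simps)
    have "ln (?c * x) = ln x + (- \<alpha>0 * t)" using x by (simp add: ln_mult)
    then have 4: "VexpC (ln (?c * x)) = VexpC (ln x) * ?B" by (simp only: VexpC_add)
    show "(?c * x) powi j * exp (of_int j * \<alpha>0 * t)
        * exp (\<alpha>1 / \<alpha>0 * (?c * x) * exp (\<alpha>0 * t) - \<alpha>2 / \<alpha>0 * inverse (?c * x) * exp (- \<alpha>0 * t)) * VexpC (ln (?c * x)) $$ (r,c)
      = x powi j * exp (- (- (\<alpha>1 / \<alpha>0) * x) - \<alpha>2 / \<alpha>0 * inverse x) * (VexpC (ln x) * ?B) $$ (r,c)"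
      by (simp only: 1 2 3 4 mult.assoc[of "\<alpha>2 / \<alpha>0"])
  qed simp
  also have "\<dots> = (mom p \<alpha>0 \<alpha>1 \<alpha>2 V C 0 j * (?c \<cdot>\<^sub>m ?B)) $$ (r,c)"
    unfolding weight_int_sum[OF rc B] using rc B
    by (subst index_mult_mat_sum[OF mom_carrier])
      (auto simp: mom_0_index sum_distrib_left mult_ac intro!: sum.cong)
  finally show "mom p \<alpha>0 \<alpha>1 \<alpha>2 V C t j $$ (r,c) = (mom p \<alpha>0 \<alpha>1 \<alpha>2 V C 0 j * (?c \<cdot>\<^sub>m ?B)) $$ (r,c)" .
qed (use C in \<open>auto simp: mom_def mexp_def\<close>)

text \<open>The right factors form a one-parameter group in \<open>t\<close>, so the inverse of the
  factor at \<open>t\<close> is the one at \<open>- t\<close>.\<close>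

lemma mom_scaling_inverse:
  fixes t :: real
  defines "B \<equiv> \<lambda>t. exp (- \<alpha>0 * t) \<cdot>\<^sub>m mexp ((- \<alpha>0 * t) \<cdot>\<^sub>m C)"
  shows "B t \<in> carrier_mat p p" "B t * B (- t) = 1\<^sub>m p"
proof -
  show "B t \<in> carrier_mat p p" for t using C by (auto simp: B_def)
  have "B t * B (- t) = (exp (- \<alpha>0 * t) * exp (- \<alpha>0 * (- t))) \<cdot>\<^sub>m (mexp ((- \<alpha>0 * t) \<cdot>\<^sub>m C) * mexp ((- \<alpha>0 * (- t)) \<cdot>\<^sub>m C))"
    unfolding B_def using C by (intro eq_matI) (auto simp: mexp_def)
  also have "mexp ((- \<alpha>0 * t) \<cdot>\<^sub>m C) * mexp ((- \<alpha>0 * (- t)) \<cdot>\<^sub>m C) = 1\<^sub>m p"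
    unfolding mexp_add_smult[OF C, symmetric] using mexp_0_smult[OF C] by simp
  finally show "B t * B (- t) = 1\<^sub>m p" by (simp flip: exp_add) (rule eq_matI, auto)
qed

text \<open>Integration by parts applied to each entry of \<open>VexpC\<close> and multiplied by
  \<alpha>0. The term \<open>- \<alpha>0\<close> times the moment stems from
  \<open>of_int j + 1\<close> there.\<close>

lemma mom_Pearson:
  "(of_int j * \<alpha>0) \<cdot>\<^sub>m mom p \<alpha>0 \<alpha>1 \<alpha>2 V C 0 j + \<alpha>1 \<cdot>\<^sub>m mom p \<alpha>0 \<alpha>1 \<alpha>2 V C 0 (j + 1)
      + \<alpha>2 \<cdot>\<^sub>m mom p \<alpha>0 \<alpha>1 \<alpha>2 V C 0 (j - 1)
    = mom p \<alpha>0 \<alpha>1 \<alpha>2 V C 0 j * (- \<alpha>0 \<cdot>\<^sub>m (1\<^sub>m p + C))" (is "?L = ?R")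
proof (rule eq_matI)
  let ?m = "mom p \<alpha>0 \<alpha>1 \<alpha>2 V C 0"
  fix r c assume "r < dim_row ?R" "c < dim_col ?R"
  then have rc: "r < p" "c < p" using C by (auto simp: mom_def)
  have CV: "continuous_on UNIV (\<lambda>s. (VexpC s * C) $$ (r,c))" "exp_growth (\<lambda>s. (VexpC s * C) $$ (r,c))"
    unfolding VexpC_mult_index[OF rc C] using rc
    by (auto intro!: continuous_intros VexpC_continuous exp_growth_sum exp_growth_mult_right VexpC_exp_growth)
  have "(of_int j + 1) * ?m j $$ (r,c) - (- (\<alpha>1 / \<alpha>0)) * ?m (j + 1) $$ (r,c) + \<alpha>2 / \<alpha>0 * ?m (j - 1) $$ (r,c)
      + (\<Sum>l<p. ?m j $$ (r,l) * C $$ (l,c)) = 0"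
    using weight_by_parts[OF VexpC_DERIV[OF rc] CV(1) VexpC_exp_growth[OF rc] CV(2), of "- (\<alpha>1 / \<alpha>0)" "\<alpha>2 / \<alpha>0" j] \<alpha> rc
    by (simp only: mom_0_index weight_int_sum[OF rc C]) (simp add: mom_0_index)
  also have "(\<Sum>l<p. ?m j $$ (r,l) * C $$ (l,c)) = (?m j * C) $$ (r,c)"
    by (rule index_mult_mat_sum[OF mom_carrier C rc, symmetric])
  finally have "of_int j * \<alpha>0 * ?m j $$ (r,c) + \<alpha>1 * ?m (j + 1) $$ (r,c) + \<alpha>2 * ?m (j - 1) $$ (r,c)
     = - \<alpha>0 * (?m j $$ (r,c) + (?m j * C) $$ (r,c))"
    using \<alpha>(1) by (simp add: field_simps del: index_mult_mat(1))
  moreover have "?R = - \<alpha>0 \<cdot>\<^sub>m (?m j + ?m j * C)"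
    using C mom_carrier[of p \<alpha>0 \<alpha>1 \<alpha>2 V C 0 j] by (simp add: mult_smult_distrib[of _ p p _ p] mult_add_distrib_mat[of _ p p _ p])
  ultimately show "?L $$ (r,c) = ?R $$ (r,c)"
    using rc C by (simp add: mom_def del: index_mult_mat(1))
qed (use C in \<open>auto simp: mom_def\<close>)

end

end

section \<open>Biorthogonal polynomials in terms of moments\<close>

lemma minv_inverts:
  assumes A: "A \<in> carrier_mat n n" and inv: "invertible_mat A"
  shows "minv A \<in> carrier_mat n n" "A * minv A = 1\<^sub>m n" "minv A * A = 1\<^sub>m n"
proof -
  \<comment> \<open>Invertibility gives a witness without fixing its size; its dimensions are read
    off from the two identities.\<close>
  obtain B where B: "A * B = 1\<^sub>m (dim_row A)" "B * A = 1\<^sub>m (dim_row B)"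
    using inv by (auto simp: invertible_mat_def inverts_mat_def)
  have "dim_row B = n"
    using A arg_cong[OF B(2), of dim_col] by auto
  moreover have "dim_col B = n"
    using A arg_cong[OF B(1), of dim_col] by auto
  ultimately have "\<exists>B. B \<in> carrier_mat (dim_row A) (dim_row A) \<and> inverts_mat A B \<and> inverts_mat B A"
    using A B by (auto simp: inverts_mat_def)
  from someI_ex[OF this] inv have "minv A \<in> carrier_mat (dim_row A) (dim_row A)"
    "inverts_mat A (minv A)" "inverts_mat (minv A) A"
    by (auto simp: minv_def)
  with A show "minv A \<in> carrier_mat n n" "A * minv A = 1\<^sub>m n" "minv A * A = 1\<^sub>m n"
    by (auto simp: inverts_mat_def)
qed

lemma minv_eqI:
  assumes A: "A \<in> carrier_mat n n" and B: "B \<in> carrier_mat n n" and AB: "A * B = 1\<^sub>m n" "B * A = 1\<^sub>m n"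
  shows "minv A = B"
proof -
  have inv: "invertible_mat A"
    unfolding invertible_mat_def inverts_mat_def using assms by (auto intro!: exI[of _ B])
  note minv = minv_inverts[OF A inv]
  have "minv A = minv A * (A * B)" using minv AB by simp
  also have "\<dots> = (minv A * A) * B" using minv A B by (intro assoc_mult_mat[symmetric]) auto
  finally show ?thesis using minv B by simp
qed

text \<open>The inverse of \<open>Z * K\<close> is \<open>K' * minv Z\<close>, so a common right
  factor cancels in a quotient. The coefficients a_n and b_n are built from such quotients.\<close>

lemma mult_minv_mult_right:
  assumes car: "X \<in> carrier_mat n n" "Z \<in> carrier_mat n n" "K \<in> carrier_mat n n" "K' \<in> carrier_mat n n"
    and inv: "invertible_mat Z" and K: "K * K' = 1\<^sub>m n" "K' * K = 1\<^sub>m n"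
  shows "X * K * minv (Z * K) = X * minv Z"
proof -
  note [simp] = minv_inverts[OF car(2) inv] car K assoc_mult_mat[of _ n n _ n _ n]
  have [simp]: "A * B \<in> carrier_mat n n" if "A \<in> carrier_mat n n" "B \<in> carrier_mat n n" for A B :: "real mat"
    using that by (rule mult_carrier_mat)
  have cancel: "K * (K' * W) = W" if "W \<in> carrier_mat n n" for W
    using that by (simp flip: assoc_mult_mat[of _ n n _ n _ n])
  have cancel': "minv Z * (Z * W) = W" if "W \<in> carrier_mat n n" for W
    using that by (simp flip: assoc_mult_mat[of _ n n _ n _ n])
  have "minv (Z * K) = K' * minv Z"
    by (rule minv_eqI[of _ n]) (simp_all add: cancel cancel')
  then show ?thesis by (simp add: cancel)
qed

text \<open>Passes from the flat index of a block matrix to pairs of a block number and a position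
  inside the block.\<close>

lemma sum_div_mod:
  fixes g :: "nat \<Rightarrow> nat \<Rightarrow> 'a::comm_monoid_add"
  shows "(\<Sum>i<n * p. g (i div p) (i mod p)) = (\<Sum>k<n. \<Sum>l<p. g k l)"
proof -
  have "(\<Sum>i<n * p. g (i div p) (i mod p)) = (\<Sum>k<n. \<Sum>i = k * p..<k * p + p. g (i div p) (i mod p))"
    by (rule sum.nat_group[symmetric])
  also have "\<dots> = (\<Sum>k<n. \<Sum>l<p. g k l)"
  proof (rule sum.cong[OF refl])
    fix k
    show "(\<Sum>i = k * p..<k * p + p. g (i div p) (i mod p)) = (\<Sum>l<p. g k l)"
      using sum.shift_bounds_nat_ivl[of "\<lambda>i. g (i div p) (i mod p)" 0 "k * p" p]
      by (simp add: atLeast0LessThan add.commute)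
  qed
  finally show ?thesis .
qed

text \<open>This is \<open>\<integral> F(\<lambda>) d\<mu>(\<lambda>) \<lambda>^(-j)\<close> for the matrix polynomial \<open>F(\<lambda>) = (\<Sum>k<N. f k \<lambda>^k)\<close>,
  expressed through the moments.\<close>

definition pairing :: "nat \<Rightarrow> (int \<Rightarrow> real mat) \<Rightarrow> nat \<Rightarrow> (nat \<Rightarrow> real mat) \<Rightarrow> int \<Rightarrow> real mat" where
  "pairing p m N f j = mat p p (\<lambda>(r,s). \<Sum>k<N. (f k * m (int k - j)) $$ (r,s))"

definition times_lambda :: "nat \<Rightarrow> (nat \<Rightarrow> real mat) \<Rightarrow> nat \<Rightarrow> real mat" where
  "times_lambda p f k = (if k = 0 then 0\<^sub>m p p else f (k - 1))"

text \<open>No measure occurs here, only a moment sequence; hence the results apply both to the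
  moments at time 0 and to their multiples by a right factor.\<close>

locale moments =
  fixes p :: nat and m :: "int \<Rightarrow> real mat"
  assumes m_carrier [simp]: "m j \<in> carrier_mat p p"
    and LamB_invertible: "invertible_mat (LamB p m n)"
begin

abbreviation mats :: "real mat set" where "mats \<equiv> carrier_mat p p"

lemma mats_mult [simp]: "A \<in> mats \<Longrightarrow> B \<in> mats \<Longrightarrow> A * B \<in> mats"
  by (rule mult_carrier_mat)

lemma mats_diff [simp]: "B \<in> mats \<Longrightarrow> A - B \<in> mats"
  by (rule minus_carrier_mat)

lemma mats_add [simp]: "B \<in> mats \<Longrightarrow> A + B \<in> mats"
  by (rule add_carrier_mat)

lemmas m_dim [simp] = carrier_matD[OF m_carrier]

lemmas assoc = assoc_mult_mat[of _ p p _ p _ p]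
lemmas mult_index = index_mult_mat_sum[of _ p p _ p]

section \<open>Linearity and shift properties of the pairing\<close>

lemma pairing_carrier [simp]: "pairing p m N f j \<in> mats"
  by (simp add: pairing_def)

lemma pairing_index:
  assumes "\<And>k. f k \<in> mats" "r < p" "s < p"
  shows "pairing p m N f j $$ (r,s) = (\<Sum>k<N. \<Sum>l<p. f k $$ (r,l) * m (int k - j) $$ (l,s))"
  using assms by (simp add: pairing_def mult_index del: index_mult_mat(1))

lemma pairing_add:
  assumes f: "\<And>k. f k \<in> mats" and g: "\<And>k. g k \<in> mats"
  shows "pairing p m N (\<lambda>k. f k + g k) j = pairing p m N f j + pairing p m N g j"
  using f g carrier_matD[OF f] carrier_matD[OF g]
  by (intro eq_matI) (auto simp: pairing_def add_mult_distrib_mat[of _ p p _ _ p] sum.distrib)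

lemma pairing_diff:
  assumes f: "\<And>k. f k \<in> mats" and g: "\<And>k. g k \<in> mats"
  shows "pairing p m N (\<lambda>k. f k - g k) j = pairing p m N f j - pairing p m N g j"
  using f g carrier_matD[OF f] carrier_matD[OF g]
  by (intro eq_matI) (auto simp: pairing_def minus_mult_distrib_mat[of _ p p _ _ p] sum_subtractf)

lemma pairing_smult:
  assumes f: "\<And>k. f k \<in> mats"
  shows "pairing p m N (\<lambda>k. c \<cdot>\<^sub>m f k) j = c \<cdot>\<^sub>m pairing p m N f j"
  using f carrier_matD[OF f]
  by (intro eq_matI) (auto simp: pairing_def mult_smult_assoc_mat[of _ p p _ p] sum_distrib_left)

lemma pairing_mult_left:
  assumes f: "\<And>k. f k \<in> mats" and A: "A \<in> mats"
  shows "pairing p m N (\<lambda>k. A * f k) j = A * pairing p m N f j"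
proof (rule eq_matI)
  fix r s assume "r < dim_row (A * pairing p m N f j)" "s < dim_col (A * pairing p m N f j)"
  then have rs: "r < p" "s < p" using A by (auto simp: pairing_def)
  have "pairing p m N (\<lambda>k. A * f k) j $$ (r,s) = (\<Sum>k<N. \<Sum>l<p. A $$ (r,l) * (f k * m (int k - j)) $$ (l,s))"
    using rs f A by (simp add: pairing_def assoc mult_index[of A] del: index_mult_mat(1))
  also have "\<dots> = (\<Sum>l<p. A $$ (r,l) * pairing p m N f j $$ (l,s))"
    using rs by (subst sum.swap) (simp add: pairing_def sum_distrib_left)
  finally show "pairing p m N (\<lambda>k. A * f k) j $$ (r,s) = (A * pairing p m N f j) $$ (r,s)"
    using rs A by (simp add: mult_index[of A] del: index_mult_mat(1))
qed (use A in \<open>auto simp: pairing_def\<close>)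

text \<open>The coefficients of the polynomial stand to the left of the moments, so a right factor
  of the moments passes through.\<close>

lemma pairing_moments_mult_right:
  assumes f: "\<And>k. f k \<in> mats" and B: "B \<in> mats"
  shows "pairing p (\<lambda>j. m j * B) N f j = pairing p m N f j * B"
proof (rule eq_matI)
  fix r s assume "r < dim_row (pairing p m N f j * B)" "s < dim_col (pairing p m N f j * B)"
  then have rs: "r < p" "s < p" using B by (auto simp: pairing_def)
  have "pairing p (\<lambda>j. m j * B) N f j $$ (r,s) = (\<Sum>k<N. \<Sum>l<p. (f k * m (int k - j)) $$ (r,l) * B $$ (l,s))"
    using rs f B by (simp add: pairing_def mult_index[of _ B] assoc[symmetric] del: index_mult_mat(1) assoc_mult_mat)
  also have "\<dots> = (\<Sum>l<p. pairing p m N f j $$ (r,l) * B $$ (l,s))"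
    using rs by (subst sum.swap) (simp add: pairing_def sum_distrib_right)
  finally show "pairing p (\<lambda>j. m j * B) N f j $$ (r,s) = (pairing p m N f j * B) $$ (r,s)"
    using rs B by (simp add: mult_index[of _ B] del: index_mult_mat(1))
qed (use B in \<open>auto simp: pairing_def\<close>)

lemma times_lambda_carrier [simp]: "(\<And>k. f k \<in> mats) \<Longrightarrow> times_lambda p f k \<in> mats"
  by (simp add: times_lambda_def)

text \<open>The scalar \<lambda> moves across the measure, where it lowers \<open>j\<close> by
  one.\<close>

lemma pairing_times_lambda:
  "pairing p m (Suc N) (times_lambda p f) j = pairing p m N f (j - 1)"
proof -
  have shift: "int (Suc k) - j = int k - (j - 1)" for k by simp
  show ?thesis
    by (intro eq_matI)
      (simp_all add: shift pairing_def times_lambda_def sum.lessThan_Suc_shift del: sum.lessThan_Suc of_nat_Suc)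
qed

text \<open>\<open>N\<close> is only a truncation bound; polynomials of different degrees can thus
  be paired with one common \<open>N\<close>.\<close>

lemma pairing_extend:
  assumes "n \<le> N" "\<And>k. n \<le> k \<Longrightarrow> f k = 0\<^sub>m p p"
  shows "pairing p m N f j = pairing p m n f j"
proof -
  have "(\<Sum>k<N. (f k * m (int k - j)) $$ (r,s)) = (\<Sum>k<n. (f k * m (int k - j)) $$ (r,s))"
    if "r < p" "s < p" for r s
    using assms that by (intro sum.mono_neutral_right) auto
  then show ?thesis by (intro eq_matI) (auto simp: pairing_def)
qed

section \<open>Block rows, the matrix \<Lambda>, and nondegeneracy of the pairing\<close>

lemma LamB_carrier [simp]: "LamB p m n \<in> carrier_mat (n * p) (n * p)"
  by (simp add: LamB_def)

lemma thetaB_carrier [simp]: "thetaB p m n \<in> carrier_mat p (n * p)"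
  by (simp add: thetaB_def)

lemma colB_carrier [simp]: "colB p f n \<in> carrier_mat (n * p) p"
  by (simp add: colB_def)

lemma block_col_lt: "j < n \<Longrightarrow> s < p \<Longrightarrow> j * p + s < n * p"
  by (metis add.commute mult_Suc mult_le_mono1 Suc_leI less_le_trans nat_add_left_cancel_less)

definition block :: "real mat \<Rightarrow> nat \<Rightarrow> real mat" where
  "block X k = mat p p (\<lambda>(r,l). X $$ (r, k * p + l))"

lemma block_carrier [simp]: "block X k \<in> mats"
  by (simp add: block_def)

text \<open>The link between \<Lambda> and the pairing: reading a block row as the coefficients of a
  polynomial, its product with \<Lambda> lists the pairings for \<open>j < n\<close>.\<close>

lemma mult_LamB_index:
  assumes X: "X \<in> carrier_mat p (n * p)" and "r < p" "s < p" "j < n"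
  shows "(X * LamB p m n) $$ (r, j * p + s) = (\<Sum>k<n. (block X k * m (int k - int j)) $$ (r,s))"
proof -
  have "(X * LamB p m n) $$ (r, j * p + s) = (\<Sum>i<n * p. X $$ (r, i div p * p + i mod p) * m (int (i div p) - int j) $$ (i mod p, s))"
    using assms by (subst index_mult_mat_sum[OF X LamB_carrier]) (auto simp: LamB_def block_col_lt)
  also have "\<dots> = (\<Sum>k<n. \<Sum>l<p. X $$ (r, k * p + l) * m (int k - int j) $$ (l, s))"
    by (rule sum_div_mod)
  finally show ?thesis using assms by (simp add: mult_index block_def del: index_mult_mat(1))
qed

lemma mult_colB_index:
  assumes X: "X \<in> carrier_mat p (n * p)" and "r < p" "s < p" and f: "\<And>i. f i \<in> mats"
  shows "(X * colB p f n) $$ (r, s) = (\<Sum>k<n. (block X k * f k) $$ (r,s))"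
proof -
  have "(X * colB p f n) $$ (r, s) = (\<Sum>i<n * p. X $$ (r, i div p * p + i mod p) * f (i div p) $$ (i mod p, s))"
    using assms by (subst index_mult_mat_sum[OF X colB_carrier]) (auto simp: colB_def)
  also have "\<dots> = (\<Sum>k<n. \<Sum>l<p. X $$ (r, k * p + l) * f k $$ (l, s))"
    by (rule sum_div_mod)
  finally show ?thesis using assms by (simp add: mult_index block_def del: index_mult_mat(1))
qed

text \<open>The coefficients, written as one block row \<open>F\<close>, satisfy
  \<open>F * LamB p m n = 0\<close>, and \<Lambda> is invertible. The polynomial identities below
  are proved this way: bound the degree of the difference, then check its first \<open>n\<close>
  pairings.\<close>

lemma pairing_eq_0_imp:
  assumes f: "\<And>k. f k \<in> mats" and deg: "\<And>k. n \<le> k \<Longrightarrow> f k = 0\<^sub>m p p" and "n \<le> N"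
    and orth: "\<And>j. j < n \<Longrightarrow> pairing p m N f (int j) = 0\<^sub>m p p"
  shows "f k = 0\<^sub>m p p"
proof (cases "k < n")
  case True
  define F where "F = mat p (n * p) (\<lambda>(r,c). f (c div p) $$ (r, c mod p))"
  have F: "F \<in> carrier_mat p (n * p)" by (simp add: F_def)
  have blk: "block F k = f k" if "k < n" for k
    using that f[of k] by (intro eq_matI) (auto simp: block_def F_def block_col_lt)
  have "F * LamB p m n = 0\<^sub>m p (n * p)"
  proof (rule eq_matI)
    fix r c assume "r < dim_row (0\<^sub>m p (n * p) :: real mat)" "c < dim_col (0\<^sub>m p (n * p) :: real mat)"
    then have rc: "r < p" "c < n * p" by auto
    define j s where "j = c div p" and "s = c mod p"
    have js: "j < n" "s < p" "c = j * p + s"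
      using rc by (auto simp: j_def s_def less_mult_imp_div_less)
    have "(F * LamB p m n) $$ (r, c) = pairing p m n f (int j) $$ (r,s)"
      using js rc mult_LamB_index[OF F, of r s j] by (simp add: pairing_def blk)
    also have "\<dots> = 0"
      using orth[of j] pairing_extend[OF \<open>n \<le> N\<close> deg] js rc by auto
    finally show "(F * LamB p m n) $$ (r, c) = 0\<^sub>m p (n * p) $$ (r, c)"
      using rc by simp
  qed (auto simp: F_def LamB_def)
  note minv = minv_inverts[OF LamB_carrier LamB_invertible, of n]
  have "F = F * (LamB p m n * minv (LamB p m n))" using minv F by simp
  also have "\<dots> = F * LamB p m n * minv (LamB p m n)"
    using minv F by (intro assoc_mult_mat[symmetric]) auto
  also have "\<dots> = 0\<^sub>m p (n * p)"
    using minv \<open>F * LamB p m n = _\<close> by simp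
  finally have "block F k = 0\<^sub>m p p"
    using True by (intro eq_matI) (auto simp: block_def block_col_lt)
  then show ?thesis using blk True by simp
qed (use deg in auto)

section \<open>The polynomials P_n: orthogonality, and H_n and \<tau>_n as pairings\<close>

abbreviation "\<gamma> \<equiv> gammaC p m"
abbreviation "H \<equiv> HH p m"
abbreviation "\<tau> \<equiv> tauM p m"

definition theta_LamB_inv :: "nat \<Rightarrow> real mat" where
  "theta_LamB_inv n = thetaB p m n * minv (LamB p m n)"

lemma theta_LamB_inv_carrier [simp]: "theta_LamB_inv n \<in> carrier_mat p (n * p)"
  unfolding theta_LamB_inv_def by (rule mult_carrier_mat[OF thetaB_carrier minv_inverts(1)[OF LamB_carrier LamB_invertible]])

lemma gamma_eq_block: "\<gamma> n k = (if k = n then 1\<^sub>m p else if k < n then - block (theta_LamB_inv n) k else 0\<^sub>m p p)"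
  by (intro eq_matI) (auto simp: gammaC_def block_def theta_LamB_inv_def)

lemma gamma_carrier [simp]: "\<gamma> n k \<in> mats"
  by (simp add: gamma_eq_block)

lemma gamma_diag [simp]: "\<gamma> n n = 1\<^sub>m p"
  by (simp add: gammaC_def)

lemma gamma_above [simp]: "n < k \<Longrightarrow> \<gamma> n k = 0\<^sub>m p p"
  by (simp add: gammaC_def)

text \<open>The index \<open>j\<close> is arbitrary: \<open>0 \<le> j < n\<close> yields
  orthogonality, \<open>j = n\<close> yields H_n, and \<open>j = -1\<close> yields \<tau>_n.\<close>

lemma pairing_gamma_index:
  assumes "n < N" "r < p" "s < p"
  shows "pairing p m N (\<gamma> n) j $$ (r,s)
    = m (int n - j) $$ (r,s) - (\<Sum>k<n. (block (theta_LamB_inv n) k * m (int k - j)) $$ (r,s))"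
proof -
  have "pairing p m N (\<gamma> n) j = pairing p m (Suc n) (\<gamma> n) j"
    using assms by (intro pairing_extend) auto
  also have "\<dots> $$ (r,s) = (\<Sum>k<n. (- block (theta_LamB_inv n) k * m (int k - j)) $$ (r,s)) + m (int n - j) $$ (r,s)"
    using assms left_mult_one_mat[OF m_carrier]
    by (simp add: pairing_def gamma_eq_block del: index_mult_mat(1))
  also have "(\<Sum>k<n. (- block (theta_LamB_inv n) k * m (int k - j)) $$ (r,s)) = - (\<Sum>k<n. (block (theta_LamB_inv n) k * m (int k - j)) $$ (r,s))"
    using assms unfolding sum_negf[symmetric]
    by (intro sum.cong refl) (simp add: block_def)
  finally show ?thesis by simp
qed

text \<open>Multiplying the coefficient row by \<Lambda> cancels the inverse and returns the row
  \<theta>_n, which is the contribution of the leading term.\<close>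

lemma pairing_gamma_orth:
  assumes "n < N" "j < n"
  shows "pairing p m N (\<gamma> n) (int j) = 0\<^sub>m p p"
proof (rule eq_matI)
  fix r s assume "r < dim_row (0\<^sub>m p p :: real mat)" "s < dim_col (0\<^sub>m p p :: real mat)"
  then have rs: "r < p" "s < p" by auto
  note minv = minv_inverts[OF LamB_carrier LamB_invertible, of n]
  have "theta_LamB_inv n * LamB p m n = thetaB p m n * (minv (LamB p m n) * LamB p m n)"
    unfolding theta_LamB_inv_def using minv by (intro assoc_mult_mat[OF thetaB_carrier _ LamB_carrier]) auto
  also have "\<dots> = thetaB p m n" using minv by (simp add: right_mult_one_mat[OF thetaB_carrier])
  finally have "thetaB p m n $$ (r, j * p + s) = (\<Sum>k<n. (block (theta_LamB_inv n) k * m (int k - int j)) $$ (r,s))"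
    using mult_LamB_index[OF theta_LamB_inv_carrier rs \<open>j < n\<close>] by simp
  moreover have "thetaB p m n $$ (r, j * p + s) = m (int n - int j) $$ (r,s)"
    using rs assms by (simp add: thetaB_def block_col_lt)
  ultimately show "pairing p m N (\<gamma> n) (int j) $$ (r,s) = 0\<^sub>m p p $$ (r,s)"
    using rs by (simp add: pairing_gamma_index[OF \<open>n < N\<close>])
qed (auto simp: pairing_def)

lemma HH_carrier [simp]: "H n \<in> mats"
  unfolding HH_def theta_LamB_inv_def[symmetric] by (intro minus_carrier_mat mult_carrier_mat[OF theta_LamB_inv_carrier colB_carrier])

lemma tauM_carrier [simp]: "\<tau> n \<in> mats"
  unfolding tauM_def theta_LamB_inv_def[symmetric] by (intro minus_carrier_mat mult_carrier_mat[OF theta_LamB_inv_carrier colB_carrier])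

text \<open>From here on H_n enters only through this pairing, and \<tau>_n through the analogous
  one at \<open>j = -1\<close>, so no explicit inverse of \<Lambda> has to be handled again.\<close>

lemma pairing_gamma_HH:
  assumes "n < N"
  shows "pairing p m N (\<gamma> n) (int n) = H n"
proof (rule eq_matI)
  fix r s assume "r < dim_row (H n)" "s < dim_col (H n)"
  then have rs: "r < p" "s < p" using carrier_matD[OF HH_carrier[of n]] by auto
  have "theta_LamB_inv n * colB p (\<lambda>i. m (int i - int n)) n \<in> mats"
    by (rule mult_carrier_mat[OF theta_LamB_inv_carrier colB_carrier])
  then show "pairing p m N (\<gamma> n) (int n) $$ (r,s) = H n $$ (r,s)"
    using rs assms
    by (simp add: HH_def theta_LamB_inv_def[symmetric] pairing_gamma_index mult_colB_index[OF theta_LamB_inv_carrier]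
        carrier_matD[OF theta_LamB_inv_carrier] carrier_matD[OF colB_carrier] add.commute del: index_mult_mat(1))
qed (use carrier_matD[OF HH_carrier[of n]] in \<open>auto simp: pairing_def\<close>)

lemma pairing_gamma_tauM:
  assumes "n < N"
  shows "pairing p m N (\<gamma> n) (-1) = \<tau> n"
proof (rule eq_matI)
  fix r s assume "r < dim_row (\<tau> n)" "s < dim_col (\<tau> n)"
  then have rs: "r < p" "s < p" using carrier_matD[OF tauM_carrier[of n]] by auto
  have "theta_LamB_inv n * colB p (\<lambda>i. m (int i + 1)) n \<in> mats"
    by (rule mult_carrier_mat[OF theta_LamB_inv_carrier colB_carrier])
  then show "pairing p m N (\<gamma> n) (-1) $$ (r,s) = \<tau> n $$ (r,s)"
    using rs assms
    by (simp add: tauM_def theta_LamB_inv_def[symmetric] pairing_gamma_index mult_colB_index[OF theta_LamB_inv_carrier]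
        carrier_matD[OF theta_LamB_inv_carrier] carrier_matD[OF colB_carrier] add.commute del: index_mult_mat(1))
qed (use carrier_matD[OF tauM_carrier[of n]] in \<open>auto simp: pairing_def\<close>)

end

section \<open>Moments with a common right factor\<close>

lemma eq_mat_if_diff_0:
  fixes A B :: "'a::ring_1 mat"
  assumes A: "A \<in> carrier_mat n n" and B: "B \<in> carrier_mat n n" and "A - B = 0\<^sub>m n n"
  shows "A = B"
proof (rule eq_matI)
  fix i j assume "i < dim_row B" "j < dim_col B"
  then show "A $$ (i,j) = B $$ (i,j)"
    using arg_cong[OF assms(3), of "\<lambda>M. M $$ (i,j)"] A B by simp
qed (use A B in auto)

lemma mat_add_eq_0_imp:
  fixes A B :: "'a::ring_1 mat"
  assumes A: "A \<in> carrier_mat n n" and B: "B \<in> carrier_mat n n" and "A + B = 0\<^sub>m n n"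
  shows "A = - B"
proof (rule eq_matI)
  fix i j assume "i < dim_row (- B)" "j < dim_col (- B)"
  then show "A $$ (i,j) = (- B) $$ (i,j)"
    using arg_cong[OF assms(3), of "\<lambda>M. M $$ (i,j)"] A B by (simp add: eq_neg_iff_add_eq_0)
qed (use A B in auto)

context moments
begin

lemmas moments_dims [simp] = carrier_matD[OF gamma_carrier] carrier_matD[OF HH_carrier] carrier_matD[OF tauM_carrier]
  carrier_matD[OF pairing_carrier]

text \<open>P_n is orthogonal for the scaled moments too, so uniqueness identifies the two families.
  H_n and \<tau>_n are then pairings of the same polynomial and pick up the factor
  \<open>K\<close>.\<close>

lemma scaled_moments:
  assumes K: "K \<in> mats"
    and "moments p (\<lambda>j. m j * K)"
  shows gammaC_scale: "gammaC p (\<lambda>j. m j * K) n k = \<gamma> n k"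
    and HH_scale: "HH p (\<lambda>j. m j * K) n = H n * K"
    and tauM_scale: "tauM p (\<lambda>j. m j * K) n = \<tau> n * K"
proof -
  interpret S: moments p "\<lambda>j. m j * K" by fact
  have eq: "S.\<gamma> n = \<gamma> n" for n
  proof (rule ext)
    fix k
    have "S.\<gamma> n k - \<gamma> n k = 0\<^sub>m p p"
    \<comment> \<open>Both polynomials are monic, so the difference has degree below
      \<open>n\<close> and \<open>n\<close> pairings decide.\<close>
    proof (rule S.pairing_eq_0_imp[of "\<lambda>k. S.\<gamma> n k - \<gamma> n k" n "Suc n"])
      show "S.\<gamma> n k - \<gamma> n k = 0\<^sub>m p p" if "n \<le> k" for k
        using that by (cases "n = k") auto
      show "pairing p (\<lambda>j. m j * K) (Suc n) (\<lambda>k. S.\<gamma> n k - \<gamma> n k) (int j) = 0\<^sub>m p p" if "j < n" for j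
      proof -
        have "pairing p (\<lambda>j. m j * K) (Suc n) (\<gamma> n) (int j) = 0\<^sub>m p p"
          using that K by (simp add: pairing_moments_mult_right pairing_gamma_orth)
        moreover have "pairing p (\<lambda>j. m j * K) (Suc n) (S.\<gamma> n) (int j) = 0\<^sub>m p p"
          using that by (rule S.pairing_gamma_orth[rotated]) simp
        ultimately show ?thesis by (simp add: S.pairing_diff)
      qed
    qed auto
    then show "S.\<gamma> n k = \<gamma> n k" by (rule eq_mat_if_diff_0[rotated 2]) auto
  qed
  show "S.\<gamma> n k = \<gamma> n k" by (simp add: eq)
  show "S.H n = H n * K" "S.\<tau> n = \<tau> n * K"
    using K by (simp_all add: eq pairing_moments_mult_right pairing_gamma_HH pairing_gamma_tauM
        flip: S.pairing_gamma_HH[of _ "Suc n"] S.pairing_gamma_tauM[of _ "Suc n"])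
qed

text \<open>These values turn the separate definition of b_0 into \<tau>_0 times the inverse of
  H_0.\<close>

lemma HH_0: "H 0 = m 0" and tauM_0: "\<tau> 0 = m 1"
proof -
  show "H 0 = m 0"
    by (intro eq_matI) (auto simp: pairing_gamma_index simp flip: pairing_gamma_HH[of 0 1, simplified])
  show "\<tau> 0 = m 1"
    by (intro eq_matI) (auto simp: pairing_gamma_index simp flip: pairing_gamma_tauM[of 0 1, simplified])
qed

end

section \<open>Three-term recurrence\<close>

locale regular_moments = moments +
  assumes HH_invertible: "invertible_mat (HH p m n)"
    and tauM_invertible: "invertible_mat (tauM p m n)"
    and bM_invertible: "invertible_mat (bM p m n)"
begin

abbreviation "a \<equiv> aM p m"
abbreviation "b \<equiv> bM p m"

lemmas minv_HH [simp] = minv_inverts[OF HH_carrier HH_invertible]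
lemmas minv_tauM [simp] = minv_inverts[OF tauM_carrier tauM_invertible]

lemma aM_carrier [simp]: "a n \<in> mats"
  by (simp add: aM_def)

lemma bM_carrier [simp]: "b n \<in> mats"
  by (simp add: bM_def flip: HH_0)

lemmas minv_bM [simp] = minv_inverts[OF bM_carrier bM_invertible]

lemmas regular_moments_dims [simp] = carrier_matD[OF aM_carrier] carrier_matD[OF bM_carrier] carrier_matD[OF minv_bM(1)]
  carrier_matD[OF minv_HH(1)] carrier_matD[OF minv_tauM(1)]

lemma aM_scale:
  assumes K: "K \<in> mats" "K' \<in> mats" "K * K' = 1\<^sub>m p" "K' * K = 1\<^sub>m p"
    and S: "moments p (\<lambda>j. m j * K)"
  shows "aM p (\<lambda>j. m j * K) n = a n"
  using K by (simp add: aM_def tauM_scale[OF K(1) S] mult_minv_mult_right[OF _ _ K(1,2) tauM_invertible K(3,4)])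

lemma bM_scale:
  assumes K: "K \<in> mats" "K' \<in> mats" "K * K' = 1\<^sub>m p" "K' * K = 1\<^sub>m p"
    and S: "moments p (\<lambda>j. m j * K)"
  shows "bM p (\<lambda>j. m j * K) n = b n"
proof (cases "n = 0")
  case True
  then show ?thesis
    using mult_minv_mult_right[OF _ _ K(1,2) HH_invertible K(3,4), of "m 1" 0] by (simp add: bM_def HH_0)
next
  case False
  have "a n * (H (n - 1) * K) * minv (H n * K) = (a n * H (n - 1)) * K * minv (H n * K)"
    using K by (simp add: assoc)
  also have "\<dots> = a n * H (n - 1) * minv (H n)"
    by (rule mult_minv_mult_right[OF _ _ K(1,2) HH_invertible K(3,4)]) auto
  finally show ?thesis
    using False by (simp add: bM_def aM_scale[OF K S] HH_scale[OF K(1) S])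
qed

lemma mult_minv_cancel:
  assumes "A \<in> mats"
  shows "A * minv (H n) * H n = A" "A * minv (\<tau> n) * \<tau> n = A" "b n * (minv (b n) * A) = A"
  using assms assoc_mult_mat[of "b n" p p "minv (b n)" p A p]
  by (simp_all add: assoc_mult_mat[of A p p _ p _ p])

text \<open>Together with the next lemma: the definitions of a_n and b_n cleared of inverses, the
  form in which they meet the pairings at \<open>j = 0\<close> and \<open>j = n\<close>.\<close>

lemma aM_tauM: "1 \<le> n \<Longrightarrow> a n * \<tau> (n - 1) = - \<tau> n"
  using mult_minv_cancel(2)[of "\<tau> n" "n - 1"]
  by (simp add: aM_def uminus_mult_left_mat)

lemma bM_HH: "b n * H n = (if n = 0 then \<tau> 0 else a n * H (n - 1))"
  using mult_minv_cancel(1)[of "m 1" 0] mult_minv_cancel(1)[of "a n * H (n - 1)" n]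
  by (auto simp: bM_def tauM_0 HH_0)

text \<open>The difference of the two sides has degree at most \<open>n\<close>, since the leading
  terms cancel. Its pairing at \<open>j = 0\<close> vanishes by the choice of a_n, at
  \<open>j = n\<close> by that of b_n, and in between by orthogonality.\<close>

lemma recurrence:
  "times_lambda p (\<gamma> n) k + a n * times_lambda p (\<gamma> (n - 1)) k = \<gamma> (n + 1) k + b n * \<gamma> n k"
proof -
  define Q where "Q k = (times_lambda p (\<gamma> n) k + a n * times_lambda p (\<gamma> (n - 1)) k) - (\<gamma> (n + 1) k + b n * \<gamma> n k)" for k
  have "Q k = 0\<^sub>m p p"
  \<comment> \<open>Degree at most \<open>n\<close> calls for \<open>n + 1\<close> pairings; the
    truncation \<open>n + 2\<close> leaves room for P_(n+1).\<close>
  proof (rule pairing_eq_0_imp[of Q "n + 1" "n + 2"])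
    show "Q k \<in> mats" for k by (simp add: Q_def)
    show "Q k = 0\<^sub>m p p" if "n + 1 \<le> k" for k
    proof -
      \<comment> \<open>For \<open>n = 0\<close> the natural number \<open>n - 1\<close> is 0 again;
        the convention \<open>a 0 = 0\<close> removes this spurious term.\<close>
      have "a n * times_lambda p (\<gamma> (n - 1)) k = 0\<^sub>m p p"
        using that by (cases "n = 0") (auto simp: aM_def times_lambda_def)
      moreover have "times_lambda p (\<gamma> n) k = \<gamma> (n + 1) k"
        using that by (cases "k = n + 1") (auto simp: times_lambda_def)
      ultimately show ?thesis
        using that by (simp add: Q_def)
    qed
    fix j assume "j < n + 1"
    define P where "P = (\<lambda>k j. pairing p m (n + 2) (\<gamma> k) j)"
    have tl: "pairing p m (n + 2) (times_lambda p (\<gamma> k)) i = P k (i - 1)" if "k \<le> n" for k i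
      using that pairing_extend[of "n + 1" "n + 2" "\<gamma> k" "i - 1"]
      by (simp add: P_def pairing_times_lambda)
    have "pairing p m (n + 2) Q (int j)
        = (P n (int j - 1) + a n * P (n - 1) (int j - 1)) - (P (n + 1) (int j) + b n * P n (int j))"
      unfolding Q_def P_def
      by (simp add: pairing_diff pairing_add pairing_mult_left tl[unfolded P_def, simplified])
    also have "P (n + 1) (int j) = 0\<^sub>m p p"
      unfolding P_def by (rule pairing_gamma_orth) (use \<open>j < n + 1\<close> in auto)
    also have "P n (int j - 1) = (if j = 0 then \<tau> n else 0\<^sub>m p p)"
      using pairing_gamma_tauM[of n "n + 2"] pairing_gamma_orth[of n "n + 2" "j - 1"] \<open>j < n + 1\<close>
      by (auto simp: P_def of_nat_diff)
    also have "b n * P n (int j) = (if j = n then b n * H n else 0\<^sub>m p p)"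
      using pairing_gamma_HH[of n "n + 2"] pairing_gamma_orth[of n "n + 2" j] \<open>j < n + 1\<close>
      by (auto simp: P_def)
    also have "a n * P (n - 1) (int j - 1)
        = (if n = 0 then 0\<^sub>m p p else if j = 0 then - \<tau> n else if j = n then a n * H (n - 1) else 0\<^sub>m p p)"
    proof -
      have "a n * P (n - 1) (int j - 1) = 0\<^sub>m p p" if "n = 0"
        using that by (simp add: aM_def P_def)
      moreover have "P (n - 1) (int j - 1) = \<tau> (n - 1)" if "j = 0"
        using that pairing_gamma_tauM[of "n - 1" "n + 2"] by (simp add: P_def)
      moreover have "P (n - 1) (int j - 1) = H (n - 1)" if "n \<noteq> 0" "j = n"
        using that pairing_gamma_HH[of "n - 1" "n + 2"] by (simp add: P_def of_nat_diff)
      moreover have "P (n - 1) (int j - 1) = 0\<^sub>m p p" if "j \<noteq> 0" "j \<noteq> n"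
        using that pairing_gamma_orth[of "n - 1" "n + 2" "j - 1"] \<open>j < n + 1\<close> by (simp add: P_def of_nat_diff)
      ultimately show ?thesis
        using aM_tauM[of n] by auto
    qed
    also have "b n * H n = (if n = 0 then \<tau> 0 else a n * H (n - 1))" by (rule bM_HH)
    finally show "pairing p m (n + 2) Q (int j) = 0\<^sub>m p p"
      by (simp split: if_splits) (intro impI conjI eq_matI; simp)
  qed simp
  then show ?thesis
    unfolding Q_def by (rule eq_mat_if_diff_0[rotated 2]) auto
qed

end

section \<open>Painleve-type equations\<close>

text \<open>Integration by parts turns \<open>d\<mu> = w(\<lambda>) V e^(C ln \<lambda>) d\<lambda>\<close> into this moment recurrence,
  with \<open>D = - \<alpha>0 (1 + C)\<close>; it stands in for the time evolution of the moments.\<close>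

locale Pearson_moments = regular_moments +
  fixes \<alpha>0 \<alpha>1 \<alpha>2 :: real and D :: "real mat"
  assumes D_carrier [simp]: "D \<in> carrier_mat p p"
    and Pearson: "(of_int j * \<alpha>0) \<cdot>\<^sub>m m j + \<alpha>1 \<cdot>\<^sub>m m (j + 1) + \<alpha>2 \<cdot>\<^sub>m m (j - 1) = m j * D"
begin

text \<open>The coefficients \<open>real k\<close> times \<open>f k\<close> are those of \<lambda>
  F'(\<lambda>). The moment recurrence is used at index \<open>k - j\<close>, and
  \<open>k = (k - j) + j\<close> produces the term with \<open>j\<close> on the right.\<close>

lemma pairing_deriv:
  assumes f: "\<And>k. f k \<in> mats"
  shows "\<alpha>0 \<cdot>\<^sub>m pairing p m N (\<lambda>k. real k \<cdot>\<^sub>m f k) j + \<alpha>1 \<cdot>\<^sub>m pairing p m N f (j - 1) + \<alpha>2 \<cdot>\<^sub>m pairing p m N f (j + 1)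
    = (\<alpha>0 * of_int j) \<cdot>\<^sub>m pairing p m N f j + pairing p m N f j * D" (is "?L = ?R")
proof (rule eq_matI)
  fix r s assume "r < dim_row ?R" "s < dim_col ?R"
  then have rs: "r < p" "s < p" using carrier_matD[OF D_carrier] by auto
  have entry: "\<alpha>0 * real k * m (int k - j) $$ (l,s) + \<alpha>1 * m (int k - (j - 1)) $$ (l,s) + \<alpha>2 * m (int k - (j + 1)) $$ (l,s)
      = \<alpha>0 * of_int j * m (int k - j) $$ (l,s) + (m (int k - j) * D) $$ (l,s)" if "l < p" for k l
  proof -
    have "int k - (j - 1) = int k - j + 1" "int k - (j + 1) = int k - j - 1" by auto
    then show ?thesis
      using arg_cong[OF Pearson[of "int k - j"], of "\<lambda>M. M $$ (l,s)"] that rs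
      by (simp add: algebra_simps del: index_mult_mat(1))
  qed
  have "(pairing p m N f j * D) $$ (r,s) = (\<Sum>k<N. \<Sum>l<p. f k $$ (r,l) * (m (int k - j) * D) $$ (l,s))"
    unfolding pairing_moments_mult_right[OF f D_carrier, symmetric]
    using f rs by (simp add: pairing_def mult_index[of "f _"] del: index_mult_mat(1))
  moreover have "pairing p m N (\<lambda>k. real k \<cdot>\<^sub>m f k) j $$ (r,s) = (\<Sum>k<N. \<Sum>l<p. real k * f k $$ (r,l) * m (int k - j) $$ (l,s))"
    using f rs carrier_matD[OF f] by (subst pairing_index) auto
  moreover have "(\<Sum>k<N. \<Sum>l<p. f k $$ (r,l) * (\<alpha>0 * real k * m (int k - j) $$ (l,s) + \<alpha>1 * m (int k - (j - 1)) $$ (l,s)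
      + \<alpha>2 * m (int k - (j + 1)) $$ (l,s)))
    = (\<Sum>k<N. \<Sum>l<p. f k $$ (r,l) * (\<alpha>0 * of_int j * m (int k - j) $$ (l,s) + (m (int k - j) * D) $$ (l,s)))"
    using entry by simp
  ultimately show "?L $$ (r,s) = ?R $$ (r,s)"
    using rs carrier_matD[OF D_carrier]
    by (simp add: pairing_index[OF f] sum_distrib_left sum.distrib distrib_left mult_ac del: index_mult_mat(1))
qed (use carrier_matD[OF D_carrier] in auto)

text \<open>This is the coefficient of \<lambda>^k in the formula for \<alpha>0 (\<lambda> P_n' - n
  P_n). Both sides have degree below \<open>n\<close>; pairing leaves only \<tau>_n at
  \<open>j = 0\<close> and H_n at \<open>j = n - 1\<close>, which the two terms on the right are
  made to match.\<close>

lemma derivative_relation: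
  assumes n: "1 \<le> n"
  shows "(\<alpha>0 * (real k - real n)) \<cdot>\<^sub>m \<gamma> n k
    = \<alpha>1 \<cdot>\<^sub>m (a n * (times_lambda p (\<gamma> (n - 1)) k - \<gamma> n k)) - \<alpha>2 \<cdot>\<^sub>m (minv (b n) * a n * \<gamma> (n - 1) k)"
proof -
  define B where "B = minv (b n) * a n"
  have B [simp]: "B \<in> mats" by (simp add: B_def)
  note [simp] = carrier_matD[OF B]
  have "B * H (n - 1) = minv (b n) * (b n * H n)"
    using n by (simp add: B_def bM_HH assoc)
  also have "\<dots> = minv (b n) * b n * H n"
    by (rule assoc[symmetric]) auto
  \<comment> \<open>The relation defining b_n, solved for H_n: it explains the coefficient of
    P_(n-1).\<close>
  finally have B_HH: "B * H (n - 1) = H n" by simp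
  define Q where "Q k = (\<alpha>0 \<cdot>\<^sub>m (real k \<cdot>\<^sub>m \<gamma> n k) - (\<alpha>0 * real n) \<cdot>\<^sub>m \<gamma> n k)
    - (\<alpha>1 \<cdot>\<^sub>m (a n * (times_lambda p (\<gamma> (n - 1)) k - \<gamma> n k)) - \<alpha>2 \<cdot>\<^sub>m (B * \<gamma> (n - 1) k))" for k
  have "Q k = 0\<^sub>m p p"
  proof (rule pairing_eq_0_imp[of Q n "n + 1"])
    show "Q k \<in> mats" for k by (simp add: Q_def)
    show "Q k = 0\<^sub>m p p" if "n \<le> k" for k
    proof -
      have "times_lambda p (\<gamma> (n - 1)) k = \<gamma> n k"
        using that n by (cases "k = n") (auto simp: times_lambda_def)
      moreover have "\<alpha>0 \<cdot>\<^sub>m (real k \<cdot>\<^sub>m \<gamma> n k) = (\<alpha>0 * real n) \<cdot>\<^sub>m \<gamma> n k"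
        using that by (cases "k = n") (auto intro!: eq_matI)
      ultimately show ?thesis
        using that n by (auto simp: Q_def minus_r_inv_mat[of _ p p] right_mult_zero_mat[OF B] intro!: eq_matI)
    qed
    fix j assume "j < n"
    define P where "P = pairing p m (n + 1)"
    have "P Q (int j) = (\<alpha>0 \<cdot>\<^sub>m P (\<lambda>k. real k \<cdot>\<^sub>m \<gamma> n k) (int j) - (\<alpha>0 * real n) \<cdot>\<^sub>m P (\<gamma> n) (int j))
      - (\<alpha>1 \<cdot>\<^sub>m (a n * (P (times_lambda p (\<gamma> (n - 1))) (int j) - P (\<gamma> n) (int j))) - \<alpha>2 \<cdot>\<^sub>m (B * P (\<gamma> (n - 1)) (int j)))"
      unfolding Q_def P_def by (simp add: pairing_diff pairing_smult pairing_mult_left)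
    moreover have orth: "P (\<gamma> n) (int j) = 0\<^sub>m p p"
      unfolding P_def by (rule pairing_gamma_orth) (use \<open>j < n\<close> in auto)
    moreover have "P (times_lambda p (\<gamma> (n - 1))) (int j) = (if j = 0 then \<tau> (n - 1) else 0\<^sub>m p p)"
      using pairing_gamma_tauM[of "n - 1" n] pairing_gamma_orth[of "n - 1" n "j - 1"] \<open>j < n\<close>
      by (auto simp: P_def pairing_times_lambda of_nat_diff)
    moreover have "P (\<gamma> (n - 1)) (int j) = (if j = n - 1 then H (n - 1) else 0\<^sub>m p p)"
      using pairing_gamma_HH[of "n - 1" "n + 1"] pairing_gamma_orth[of "n - 1" "n + 1" j] \<open>j < n\<close>
      by (auto simp: P_def)
    moreover have "\<alpha>0 \<cdot>\<^sub>m P (\<lambda>k. real k \<cdot>\<^sub>m \<gamma> n k) (int j)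
        = - (\<alpha>1 \<cdot>\<^sub>m (if j = 0 then \<tau> n else 0\<^sub>m p p) + \<alpha>2 \<cdot>\<^sub>m (if j = n - 1 then H n else 0\<^sub>m p p))"
    proof -
      have 1: "P (\<gamma> n) (int j - 1) = (if j = 0 then \<tau> n else 0\<^sub>m p p)"
        using pairing_gamma_tauM[of n "n + 1"] pairing_gamma_orth[of n "n + 1" "j - 1"] \<open>j < n\<close>
        by (auto simp: P_def of_nat_diff)
      have 2: "P (\<gamma> n) (int j + 1) = (if j = n - 1 then H n else 0\<^sub>m p p)"
        using pairing_gamma_HH[of n "n + 1"] pairing_gamma_orth[of n "n + 1" "j + 1"] \<open>j < n\<close>
        by (auto simp: P_def of_nat_diff add.commute)
      \<comment> \<open>Orthogonality removes both the term with \<open>j\<close> and the term with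
        \<open>D\<close>, so \<open>D\<close> does not reach the final equations.\<close>
      have "\<alpha>0 \<cdot>\<^sub>m P (\<lambda>k. real k \<cdot>\<^sub>m \<gamma> n k) (int j) + \<alpha>1 \<cdot>\<^sub>m P (\<gamma> n) (int j - 1) + \<alpha>2 \<cdot>\<^sub>m P (\<gamma> n) (int j + 1) = 0\<^sub>m p p"
        using pairing_deriv[of "\<gamma> n" "n + 1" "int j"] orth by (simp add: P_def left_mult_zero_mat[OF D_carrier])
      then have "\<alpha>0 \<cdot>\<^sub>m P (\<lambda>k. real k \<cdot>\<^sub>m \<gamma> n k) (int j) + (\<alpha>1 \<cdot>\<^sub>m P (\<gamma> n) (int j - 1) + \<alpha>2 \<cdot>\<^sub>m P (\<gamma> n) (int j + 1)) = 0\<^sub>m p p"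
        by (simp add: P_def assoc_add_mat[of _ p p])
      then show ?thesis
        unfolding 1 2 by (rule mat_add_eq_0_imp[rotated 2]) (auto simp: P_def)
    qed
    moreover have [simp]: "A - 0\<^sub>m p p = A" if "A \<in> mats" for A
      using that by (intro eq_matI) auto
    ultimately show "pairing p m (n + 1) Q (int j) = 0\<^sub>m p p"
      using aM_tauM[OF n] B_HH
      by (auto simp: P_def intro!: eq_matI simp del: index_mult_mat(1))
  qed simp
  then have "\<alpha>0 \<cdot>\<^sub>m (real k \<cdot>\<^sub>m \<gamma> n k) - (\<alpha>0 * real n) \<cdot>\<^sub>m \<gamma> n k
    = \<alpha>1 \<cdot>\<^sub>m (a n * (times_lambda p (\<gamma> (n - 1)) k - \<gamma> n k)) - \<alpha>2 \<cdot>\<^sub>m (B * \<gamma> (n - 1) k)"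
    unfolding Q_def by (rule eq_mat_if_diff_0[rotated 2]) auto
  moreover have "(\<alpha>0 * (real k - real n)) \<cdot>\<^sub>m \<gamma> n k = \<alpha>0 \<cdot>\<^sub>m (real k \<cdot>\<^sub>m \<gamma> n k) - (\<alpha>0 * real n) \<cdot>\<^sub>m \<gamma> n k"
    by (intro eq_matI) (auto simp: algebra_simps)
  ultimately show ?thesis by (simp add: B_def)
qed

text \<open>The recurrence at \<lambda>^0, where multiples of \<lambda> contribute nothing. Hence
  P_n(0) is, up to sign, a product of the b_k.\<close>

lemma gamma_const_Suc: "b n * \<gamma> n 0 = - \<gamma> (n + 1) 0"
proof -
  have "b n * \<gamma> n 0 + \<gamma> (n + 1) 0 = 0\<^sub>m p p"
    using recurrence[of n 0] comm_add_mat[of "b n * \<gamma> n 0" p p] by (simp add: times_lambda_def)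
  then show ?thesis
    by (rule mat_add_eq_0_imp[rotated 2]) auto
qed

text \<open>P_n(0) is to be cancelled on the right; a right inverse suffices for this and builds up
  factor by factor from the inverses of the b_k.\<close>

lemma gamma_const_right_inverse: "\<exists>c \<in> mats. \<gamma> n 0 * c = 1\<^sub>m p"
proof (induction n)
  case (Suc n)
  then obtain c where c: "c \<in> mats" "\<gamma> n 0 * c = 1\<^sub>m p" by blast
  have "\<gamma> (Suc n) 0 = - (b n * \<gamma> n 0)"
    using gamma_const_Suc[of n] by (intro eq_matI) auto
  then have "\<gamma> (Suc n) 0 * (- (c * minv (b n))) = b n * \<gamma> n 0 * (c * minv (b n))"
    using c by simp
  also have "\<dots> = b n * (\<gamma> n 0 * c * minv (b n))"
    using c(1) by (simp add: assoc)
  also have "\<dots> = 1\<^sub>m p" unfolding c(2) by simp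
  finally show ?case by (rule bexI) (use c in simp)
qed (use left_mult_one_mat in auto)

text \<open>The derivative relation at \<lambda>^0, with P_(n-1)(0) expressed through P_n(0), which
  then stands on the right of every term and is cancelled.\<close>

lemma const_term_relation:
  assumes n: "1 \<le> n"
  shows "(\<alpha>0 * real n) \<cdot>\<^sub>m 1\<^sub>m p = \<alpha>1 \<cdot>\<^sub>m a n - \<alpha>2 \<cdot>\<^sub>m (minv (b n) * a n * minv (b (n - 1)))"
proof -
  obtain c where c: "c \<in> mats" "\<gamma> n 0 * c = 1\<^sub>m p" using gamma_const_right_inverse by blast
  define B where "B = minv (b n) * a n"
  have B [simp]: "B \<in> mats" by (simp add: B_def)
  note [simp] = carrier_matD[OF B]
  have "\<gamma> (n - 1) 0 = minv (b (n - 1)) * (b (n - 1) * \<gamma> (n - 1) 0)"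
    by (simp flip: assoc_mult_mat[of _ p p _ p _ p])
  also have "\<dots> = - (minv (b (n - 1)) * \<gamma> n 0)"
    using gamma_const_Suc[of "n - 1"] n by simp
  finally have prev: "\<gamma> (n - 1) 0 = - (minv (b (n - 1)) * \<gamma> n 0)" .
  \<comment> \<open>\<open>E\<close> is the difference of the two sides of the claim;
    \<open>E * \<gamma> n 0 = 0\<close> is shown first.\<close>
  define E where "E = (\<alpha>0 * real n) \<cdot>\<^sub>m 1\<^sub>m p - (\<alpha>1 \<cdot>\<^sub>m a n - \<alpha>2 \<cdot>\<^sub>m (B * minv (b (n - 1))))"
  have E: "E \<in> mats" by (simp add: E_def)
  have minus: "0\<^sub>m p p - \<gamma> n 0 = - \<gamma> n 0" by (intro eq_matI) auto
  have eq: "(- (\<alpha>0 * real n)) \<cdot>\<^sub>m \<gamma> n 0 = \<alpha>1 \<cdot>\<^sub>m (- (a n * \<gamma> n 0)) - \<alpha>2 \<cdot>\<^sub>m (- (B * (minv (b (n - 1)) * \<gamma> n 0)))"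
    using derivative_relation[OF n, of 0] unfolding B_def[symmetric] prev
    by (simp add: times_lambda_def minus)
  have E_eq: "E * \<gamma> n 0 = (\<alpha>0 * real n) \<cdot>\<^sub>m \<gamma> n 0
      - (\<alpha>1 \<cdot>\<^sub>m (a n * \<gamma> n 0) - \<alpha>2 \<cdot>\<^sub>m (B * (minv (b (n - 1)) * \<gamma> n 0)))"
    unfolding E_def by (simp add: minus_mult_distrib_mat[of _ p p _ _ p] mult_smult_assoc_mat[of _ p p _ p] assoc)
  have "E * \<gamma> n 0 = 0\<^sub>m p p"
    unfolding E_eq
  proof (rule eq_matI)
    fix r s assume "r < dim_row (0\<^sub>m p p :: real mat)" "s < dim_col (0\<^sub>m p p :: real mat)"
    then show "((\<alpha>0 * real n) \<cdot>\<^sub>m \<gamma> n 0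
      - (\<alpha>1 \<cdot>\<^sub>m (a n * \<gamma> n 0) - \<alpha>2 \<cdot>\<^sub>m (B * (minv (b (n - 1)) * \<gamma> n 0)))) $$ (r,s) = 0\<^sub>m p p $$ (r,s)"
      using arg_cong[OF eq, of "\<lambda>M. M $$ (r,s)"] by (simp del: index_mult_mat(1))
  qed auto
  moreover have "E * (\<gamma> n 0 * c) = E * \<gamma> n 0 * c"
    using E c(1) by (intro assoc[symmetric]) auto
  ultimately have "E * (\<gamma> n 0 * c) = 0\<^sub>m p p" using c(1) by simp
  then have "E = 0\<^sub>m p p" using E c(2) by simp
  then show ?thesis
    unfolding E_def B_def[symmetric] by (rule eq_mat_if_diff_0[rotated 2]) auto
qed

text \<open>The value 0 at \<open>n = 0\<close>, where P_0 has no such coefficient, lets the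
  increment formula start at \<open>n = 0\<close>.\<close>

definition subleading :: "nat \<Rightarrow> real mat" where
  "subleading n = (if n = 0 then 0\<^sub>m p p else \<gamma> n (n - 1))"

lemma subleading_carrier [simp]: "subleading n \<in> mats"
  by (simp add: subleading_def)

lemmas subleading_dim [simp] = carrier_matD[OF subleading_carrier]

text \<open>The recurrence at \<lambda>^n; for \<open>n = 0\<close> it expresses P_1(0) through
  b_0.\<close>

lemma subleading_Suc: "subleading n + a n = subleading (n + 1) + b n"
proof (cases "n = 0")
  case True
  have "\<gamma> 1 0 + b 0 = 0\<^sub>m p p"
    using recurrence[of 0 0] by (simp add: times_lambda_def aM_def)
  then show ?thesis using True by (simp add: subleading_def aM_def)
next
  case False
  then show ?thesis using recurrence[of n n] by (simp add: subleading_def times_lambda_def)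
qed

text \<open>The derivative relation at \<lambda>^(n-1), where \<open>real k - real n\<close> is -1;
  the difference of subleading coefficients on its right side is replaced by the increment
  formula.\<close>

lemma subleading_eq:
  assumes n: "1 \<le> n"
  shows "\<alpha>0 \<cdot>\<^sub>m subleading n = \<alpha>2 \<cdot>\<^sub>m (minv (b n) * a n) - \<alpha>1 \<cdot>\<^sub>m (a n * b (n - 1) - a n * a (n - 1))"
proof -
  have step: "subleading (n - 1) + a (n - 1) = subleading n + b (n - 1)"
    using subleading_Suc[of "n - 1"] n by simp
  have "subleading (n - 1) - subleading n = b (n - 1) - a (n - 1)"
  proof (rule eq_matI)
    fix r s assume "r < dim_row (b (n - 1) - a (n - 1))" "s < dim_col (b (n - 1) - a (n - 1))"
    then show "(subleading (n - 1) - subleading n) $$ (r,s) = (b (n - 1) - a (n - 1)) $$ (r,s)"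
      using arg_cong[OF step, of "\<lambda>M. M $$ (r,s)"] by simp
  qed auto
  moreover have "(- \<alpha>0) \<cdot>\<^sub>m subleading n
      = \<alpha>1 \<cdot>\<^sub>m (a n * (subleading (n - 1) - subleading n)) - \<alpha>2 \<cdot>\<^sub>m (minv (b n) * a n)"
    using derivative_relation[OF n, of "n - 1"] n
    by (auto simp: subleading_def times_lambda_def of_nat_diff)
  ultimately have eq: "(- \<alpha>0) \<cdot>\<^sub>m subleading n
      = \<alpha>1 \<cdot>\<^sub>m (a n * b (n - 1) - a n * a (n - 1)) - \<alpha>2 \<cdot>\<^sub>m (minv (b n) * a n)"
    by (simp add: mult_minus_distrib_mat[of _ p p _ p])
  show ?thesis
  proof (rule eq_matI)
    fix r s assume "r < dim_row (\<alpha>2 \<cdot>\<^sub>m (minv (b n) * a n) - \<alpha>1 \<cdot>\<^sub>m (a n * b (n - 1) - a n * a (n - 1)))"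
      "s < dim_col (\<alpha>2 \<cdot>\<^sub>m (minv (b n) * a n) - \<alpha>1 \<cdot>\<^sub>m (a n * b (n - 1) - a n * a (n - 1)))"
    then show "(\<alpha>0 \<cdot>\<^sub>m subleading n) $$ (r,s)
      = (\<alpha>2 \<cdot>\<^sub>m (minv (b n) * a n) - \<alpha>1 \<cdot>\<^sub>m (a n * b (n - 1) - a n * a (n - 1))) $$ (r,s)"
      using arg_cong[OF eq, of "\<lambda>M. M $$ (r,s)"] by (simp add: algebra_simps del: index_mult_mat(1))
  qed auto
qed

lemma Painleve_b:
  assumes n: "1 \<le> n"
  shows "\<alpha>0 \<cdot>\<^sub>m b n + \<alpha>1 \<cdot>\<^sub>m (b n * a n - a (n + 1) * b n)
    + \<alpha>2 \<cdot>\<^sub>m (minv (b (n + 1)) * a (n + 1) - a n * minv (b (n - 1))) = 0\<^sub>m p p"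
proof -
  \<comment> \<open>Multiplication by b_n on the left cancels the leading inverse in the relation at
    \<open>n\<close>; below, multiplication on the right cancels the trailing one in the relation at
    \<open>n + 1\<close>. The difference removes the explicit \<open>n\<close>.\<close>
  have "b n * ((\<alpha>0 * real n) \<cdot>\<^sub>m 1\<^sub>m p) = b n * (\<alpha>1 \<cdot>\<^sub>m a n - \<alpha>2 \<cdot>\<^sub>m (minv (b n) * a n * minv (b (n - 1))))"
    by (simp add: const_term_relation[OF n])
  then have 1: "(\<alpha>0 * real n) \<cdot>\<^sub>m b n = \<alpha>1 \<cdot>\<^sub>m (b n * a n) - \<alpha>2 \<cdot>\<^sub>m (a n * minv (b (n - 1)))"
    by (simp add: mult_minus_distrib_mat[of _ p p _ p] mult_smult_distrib[of _ p p _ p] assoc mult_minv_cancel)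
  have "((\<alpha>0 * real (n + 1)) \<cdot>\<^sub>m 1\<^sub>m p) * b n
      = (\<alpha>1 \<cdot>\<^sub>m a (n + 1) - \<alpha>2 \<cdot>\<^sub>m (minv (b (n + 1)) * a (n + 1) * minv (b n))) * b n"
    using const_term_relation[of "n + 1"] by simp
  then have 2: "(\<alpha>0 * real (n + 1)) \<cdot>\<^sub>m b n = \<alpha>1 \<cdot>\<^sub>m (a (n + 1) * b n) - \<alpha>2 \<cdot>\<^sub>m (minv (b (n + 1)) * a (n + 1))"
    by (simp add: minus_mult_distrib_mat[of _ p p _ _ p] mult_smult_assoc_mat[of _ p p _ p] assoc)
  show ?thesis
  proof (rule eq_matI)
    fix r s assume "r < dim_row (0\<^sub>m p p :: real mat)" "s < dim_col (0\<^sub>m p p :: real mat)"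
    then show "(\<alpha>0 \<cdot>\<^sub>m b n + \<alpha>1 \<cdot>\<^sub>m (b n * a n - a (n + 1) * b n)
      + \<alpha>2 \<cdot>\<^sub>m (minv (b (n + 1)) * a (n + 1) - a n * minv (b (n - 1)))) $$ (r,s) = 0\<^sub>m p p $$ (r,s)"
      using arg_cong[OF 1, of "\<lambda>M. M $$ (r,s)"] arg_cong[OF 2, of "\<lambda>M. M $$ (r,s)"]
      by (simp add: algebra_simps del: index_mult_mat(1))
  qed auto
qed

text \<open>The increment formula times \<alpha>0, with both subleading coefficients eliminated, is
  the difference of the two equations; adding it to the equation for b_n gives the claim. Entrywise
  this is linear once matrix products count as atoms.\<close>

lemma Painleve_a:
  assumes n: "1 \<le> n"
  shows "\<alpha>0 \<cdot>\<^sub>m a n + \<alpha>1 \<cdot>\<^sub>m (- (a (n + 1) * a n) + a n * a (n - 1) + b n * a n - a n * b (n - 1))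
    + \<alpha>2 \<cdot>\<^sub>m (minv (b n) * a n - a n * minv (b (n - 1))) = 0\<^sub>m p p"
proof (rule eq_matI)
  fix r s assume "r < dim_row (0\<^sub>m p p :: real mat)" "s < dim_col (0\<^sub>m p p :: real mat)"
  then show "(\<alpha>0 \<cdot>\<^sub>m a n + \<alpha>1 \<cdot>\<^sub>m (- (a (n + 1) * a n) + a n * a (n - 1) + b n * a n - a n * b (n - 1))
    + \<alpha>2 \<cdot>\<^sub>m (minv (b n) * a n - a n * minv (b (n - 1)))) $$ (r,s) = 0\<^sub>m p p $$ (r,s)"
    using arg_cong[OF Painleve_b[OF n], of "\<lambda>M. M $$ (r,s)"] arg_cong[OF subleading_eq[OF n], of "\<lambda>M. M $$ (r,s)"]
      arg_cong[OF subleading_eq[of "n + 1"], of "\<lambda>M. M $$ (r,s)"]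
      arg_cong[OF subleading_Suc[of n], of "\<lambda>M. \<alpha>0 * M $$ (r,s)"]
    by (simp add: algebra_simps del: index_mult_mat(1))
qed auto

end

theorem theorem3p11:
  fixes p :: nat and \<alpha>0 \<alpha>1 \<alpha>2 :: real and V C :: "real mat"
  defines "M \<equiv> \<lambda>t. mom p \<alpha>0 \<alpha>1 \<alpha>2 V C t"
  assumes "p \<ge> 1"
    and "V \<in> carrier_mat p p" and "C \<in> carrier_mat p p"
    and "\<alpha>0 \<noteq> 0" and "\<alpha>1 / \<alpha>0 < 0" and "\<alpha>2 / \<alpha>0 > 0"
    and "\<And>t n. invertible_mat (LamB p (M t) n)"
    and "\<And>t n. invertible_mat (HH p (M t) n)"
    and "\<And>t n. invertible_mat (tauM p (M t) n)"
    and "\<And>t n. invertible_mat (bM p (M t) n)"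
  shows "(\<forall>n t i j. i < p \<longrightarrow> j < p \<longrightarrow>
            ((\<lambda>s. aM p (M s) n $$ (i,j)) has_real_derivative 0) (at t)
          \<and> ((\<lambda>s. bM p (M s) n $$ (i,j)) has_real_derivative 0) (at t)
          \<and> (\<forall>k \<le> n. ((\<lambda>s. gammaC p (M s) n k $$ (i,j)) has_real_derivative 0) (at t)))
       \<and> (\<forall>n t. n \<ge> 1 \<longrightarrow>
            (let a = aM p (M t); b = bM p (M t) in
              \<alpha>0 \<cdot>\<^sub>m a n
              + \<alpha>1 \<cdot>\<^sub>m (- (a (n+1) * a n) + a n * a (n-1) + b n * a n - a n * b (n-1))
              + \<alpha>2 \<cdot>\<^sub>m (minv (b n) * a n - a n * minv (b (n-1))) = 0\<^sub>m p p
            \<and> \<alpha>0 \<cdot>\<^sub>m b n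
              + \<alpha>1 \<cdot>\<^sub>m (b n * a n - a (n+1) * b n)
              + \<alpha>2 \<cdot>\<^sub>m (minv (b (n+1)) * a (n+1) - a n * minv (b (n-1))) = 0\<^sub>m p p))"
proof -
  note V = \<open>V \<in> carrier_mat p p\<close> and C = \<open>C \<in> carrier_mat p p\<close>
  note \<alpha> = \<open>\<alpha>0 \<noteq> 0\<close> \<open>\<alpha>1 / \<alpha>0 < 0\<close> \<open>\<alpha>2 / \<alpha>0 > 0\<close>
  have M_moments: "moments p (M t)" for t
    by unfold_locales (simp_all add: M_def mom_carrier assms(8)[unfolded M_def])
  \<comment> \<open>The moment recurrence is needed at \<open>t = 0\<close> only, since the
    coefficients at every other time turn out to be the same.\<close>
  interpret Pearson_moments p "M 0" \<alpha>0 \<alpha>1 \<alpha>2 "- \<alpha>0 \<cdot>\<^sub>m (1\<^sub>m p + C)"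
    by unfold_locales
      (use mom_Pearson[OF V C \<alpha>] C in \<open>auto simp: M_def mom_carrier assms(8-11)[unfolded M_def]\<close>)
  define K where "K t = exp (- \<alpha>0 * t) \<cdot>\<^sub>m mexp ((- \<alpha>0 * t) \<cdot>\<^sub>m C)" for t
  have K: "K t \<in> carrier_mat p p" "K (- t) \<in> carrier_mat p p" "K t * K (- t) = 1\<^sub>m p" "K (- t) * K t = 1\<^sub>m p" for t
    using mom_scaling_inverse[OF V C \<alpha>, of t] mom_scaling_inverse[OF V C \<alpha>, of "- t"]
    unfolding K_def by simp_all
  have M_scale: "M t = (\<lambda>j. M 0 j * K t)" for t
    unfolding M_def K_def by (rule ext) (rule mom_scaling[OF V C \<alpha>])
  have S: "moments p (\<lambda>j. M 0 j * K t)" for t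
    using M_moments[of t] by (simp flip: M_scale)
  have "aM p (M t) n = aM p (M 0) n" "bM p (M t) n = bM p (M 0) n"
    "gammaC p (M t) n k = gammaC p (M 0) n k" for t n k
    unfolding M_scale[of t] by (rule aM_scale[OF K S] bM_scale[OF K S] gammaC_scale[OF K(1) S])+
  \<comment> \<open>With the coefficients replaced by fixed functions, the derivatives are those of
    constants, and the discrete equations at time 0 become those at every \<open>t\<close>.\<close>
  then obtain a0 b0 \<gamma>0 where const: "\<And>t. aM p (M t) = a0" "\<And>t. bM p (M t) = b0" "\<And>t. gammaC p (M t) = \<gamma>0"
    by (metis ext)
  show ?thesis
    using Painleve_a Painleve_b unfolding const Let_def by simp
qed

end
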